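(* Let $(\alpha_0,\beta_0)\in U$, let $\underline M=K(\alpha_0,\beta_0)$ (so $\beta_0=\Psi_{\underline M}(\alpha_0)$), let $\mu$ be the unique absolutely continuous invariant probability measure of $T_{\alpha_0,\beta_0}$, and let $\Lambda_{\alpha_0,\beta_0}$ be the Lyapunov exponent of $T_{\alpha_0,\beta_0}$. Then $\Psi_{\underline M}'(\alpha_0)$ exists and $$\Lambda_{\alpha_0,\beta_0}=\gamma\log\frac{\beta_0}{\alpha_0}+(1-\gamma)\log\frac{\beta_0}{1-\alpha_0},$$ where $$\gamma=\frac{\frac{\Psi'_{\underline M}(\alpha_0)}{\beta_0}+\frac{1}{1-\alpha_0}}{\frac{1}{\alpha_0}+\frac{1}{1-\alpha_0}}=\alpha_0(1-\alpha_0)\frac{\Psi'_{\underline M}(\alpha_0)}{\beta_0}+\alpha_0,$$ and moreover $\gamma=\mu([0,\alpha_0])$.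
   Context: For $0<\alpha<1$ and $0\le\beta\le1$ the skew tent map $T_{\alpha,\beta}:[0,1]\to[0,1]$ is $T_{\alpha,\beta}(x)=\frac{\beta}{\alpha}x$ for $0\le x\le\alpha$ and $T_{\alpha,\beta}(x)=\frac{\beta}{1-\alpha}(1-x)$ for $\alpha<x\le1$. Let $U=\{(\alpha,\beta): \tfrac12<\beta\le1,\ 1-\beta<\alpha<\beta\}$. For $(\alpha,\beta)\in U$ the extended kneading sequence $(\mathfrak m_1,\mathfrak m_2,\dots)\in\{L,C,R\}^{\mathbb N}$ is defined by $\mathfrak m_n=L$, $C$ or $R$ according as $T^n_{\alpha,\beta}(\alpha)<\alpha$, $=\alpha$ or $>\alpha$. The kneading sequence $K(\alpha,\beta)$ is the extended kneading sequence if it contains no $C$, and otherwise is the finite string obtained by stopping at the first $C$. Let $\mathfrak M=\{K(\alpha,\beta):(\alpha,\beta)\in U\}$. It is known that for each $\underline M\in\mathfrak M$ there exist $\alpha_1(\underline M)<\alpha_2(\underline M)$ and a continuous function $\Psi_{\underline M}$ on $(\alpha_1(\underline M),\alpha_2(\underline M))$ with $(\alpha,\Psi_{\underline M}(\alpha))\in U$ such that for $(\alpha,\beta)\in U$: $K(\alpha,\beta)=\underline M$ iff $\alpha\in(\alpha_1(\underline M),\alpha_2(\underline M))$ and $\beta=\Psi_{\underline M}(\alpha)$ (the isentrope). For $(\alpha,\beta)\in U$, $T_{\alpha,\beta}$ has a unique absolutely continuous (w.r.t. Lebesgue measure $\lambda$) invariant probability measure (acim), which is ergodic. The Lyapunov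 exponent is $\Lambda_{\alpha,\beta}=\lim_{N\to\infty}\frac1N\log|(T^N_{\alpha,\beta})'(x)|$, which exists and is the same for $\mu$-a.e. $x$ ($\mu$ the acim). *)

theory Defs
  imports "HOL-Analysis.Analysis"
begin

text \<open>The skew tent map T_{alpha,beta}; defined on all of the reals by the same formulas
  (only its restriction to [0,1] matters).\<close>
definition skew_tent :: "real \<Rightarrow> real \<Rightarrow> real \<Rightarrow> real" where
  "skew_tent a b x = (if x \<le> a then (b / a) * x else (b / (1 - a)) * (1 - x))"

text \<open>The derivative of T_{alpha,beta} (one-sided value at the turning point is irrelevant,
  the orbits of mu-almost every point never hit it).\<close>
definition skew_tent_deriv :: "real \<Rightarrow> real \<Rightarrow> real \<Rightarrow> real" where
  "skew_tent_deriv a b x = (if x \<le> a then b / a else - (b / (1 - a)))"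

definition U_region :: "(real \<times> real) set" where
  "U_region = {(a, b). 1/2 < b \<and> b \<le> 1 \<and> 1 - b < a \<and> a < b}"

datatype symb = L | C | R

text \<open>Extended kneading sequence: m_n for n \<ge> 1 (index 0 is unused).\<close>
definition ext_kneading :: "real \<Rightarrow> real \<Rightarrow> nat \<Rightarrow> symb" where
  "ext_kneading a b n =
     (let y = (skew_tent a b ^^ n) a in if y < a then L else if y = a then C else R)"

datatype kseq = Fin "symb list" | Inf "nat \<Rightarrow> symb"

definition kneading :: "real \<Rightarrow> real \<Rightarrow> kseq" where
  "kneading a b =
     (if \<forall>n\<ge>1. ext_kneading a b n \<noteq> C then Inf (\<lambda>n. ext_kneading a b (Suc n))
      else (let k = (LEAST n. n \<ge> 1 \<and> ext_kneading a b n = C)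
            in Fin (map (ext_kneading a b) [1..<Suc k])))"

text \<open>The isentrope Psi_M: for alpha in (alpha_1(M), alpha_2(M)) the unique beta with
  (alpha,beta) in U and K(alpha,beta) = M.\<close>
definition isentrope :: "kseq \<Rightarrow> real \<Rightarrow> real" where
  "isentrope M a = (THE b. (a, b) \<in> U_region \<and> kneading a b = M)"

definition is_acim :: "real \<Rightarrow> real \<Rightarrow> real measure \<Rightarrow> bool" where
  "is_acim a b \<mu> \<longleftrightarrow>
     sets \<mu> = sets borel \<and> emeasure \<mu> (space \<mu>) = 1 \<and> emeasure \<mu> {0..1} = 1 \<and>
     absolutely_continuous lborel \<mu> \<and>
     skew_tent a b \<in> borel_measurable borel \<and>
     (\<forall>A\<in>sets borel. emeasure \<mu> (skew_tent a b -` A) = emeasure \<mu> A)"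

text \<open>|(T^N)'(x)| via the chain rule: product of |T'(T^k x)|, k < N.\<close>
definition iter_deriv_abs :: "real \<Rightarrow> real \<Rightarrow> nat \<Rightarrow> real \<Rightarrow> real" where
  "iter_deriv_abs a b N x = (\<Prod>k<N. \<bar>skew_tent_deriv a b ((skew_tent a b ^^ k) x)\<bar>)"

definition is_lyapunov_exponent :: "real \<Rightarrow> real \<Rightarrow> real measure \<Rightarrow> real \<Rightarrow> bool" where
  "is_lyapunov_exponent a b \<mu> \<Lambda> \<longleftrightarrow>
     (AE x in \<mu>. (\<lambda>N. ln (iter_deriv_abs a b N x) / real N) \<longlonglongrightarrow> \<Lambda>)"

end

(*
  Let h be the affine coordinate with h(alpha) = 0, h(beta) = 1.  A change of slopes to 1/X, -1/Y
  turns h into the bounded solution of h = w (h o T - 1), w being the inverse slope X or -Y; its value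
  at beta is 1 exactly when the new map still has the given kneading sequence (near the parameter).
  To first order in the relative slope changes e, f this value is 1 - (e A + f B), which gives the
  isentrope's derivative as soon as A + B is nonzero.  If e A + f B = 0, the derivative v of the
  semiconjugacy solves a twisted cohomological equation and is continuous across the turning point, so
  the Lebesgue integrals of the Birkhoff sums of e 1_L + f 1_R over intervals telescope up to boundary
  terms, which a Lasota-Yorke estimate bounds uniformly in time.  Hence e mu(L) + f mu(R) = 0 for every
  absolutely continuous invariant probability mu; with (e, f) = (1, 1) this excludes A + B = 0, and with
  (e, f) = (B, -A) it gives mu(L) = A / (A + B).  The same estimate rules out a semiconjugacy to a map
  with both slopes multiplied by t > 1, so beta is determined by alpha and the kneading sequence.
*)

theory Submission
  imports Defs "HOL-Probability.Probability_Measure"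
begin

text \<open>All functions live on the dynamics of the single map T at the base point. The second map
  enters only through the numbers X and Y, and the equation for h has a bounded series solution for
  all of these, whether or not a semiconjugacy exists. Hence h depends on X and Y in a Lipschitz
  way, although itineraries jump when parameters move. A and B are \<open>vL b\<close> and
  \<open>vR b\<close>. The obstacle is A + B being nonzero: the products of inverse slopes in these
  series change sign, so nothing can be read off termwise. It is the total mass 1 of \<mu> that
  excludes A + B = 0. The isentrope is a definite description, so existence and uniqueness of
  \<beta> near the base point both have to be proved. Existence is an intermediate value argument in
  \<beta>. The constraint \<beta> \<le> 1 is closed and b = 1 is allowed, so it cannot come from
  continuity; it comes from the order-preserving conjugacy.\<close>

section \<open>Bounds from contraction and from subadditivity\<close>

lemma abs_le_of_eq_add:
  fixes x y z :: real
  shows "z = x + y \<Longrightarrow> \<bar>x\<bar> \<le> A \<Longrightarrow> \<bar>y\<bar> \<le> B \<Longrightarrow> \<bar>z\<bar> \<le> A + B"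
  by linarith

text \<open>With s the supremum of |f| over S, the recursion gives s \<le> \<theta> * s + K. The a
  priori bound M makes s finite and leaves no trace in the result.\<close>

lemma contraction_bound:
  fixes f :: "'a \<Rightarrow> real"
  assumes inv: "\<And>x. x \<in> S \<Longrightarrow> g x \<in> S"
    and bdd: "\<And>x. x \<in> S \<Longrightarrow> \<bar>f x\<bar> \<le> M"
    and rec: "\<And>x. x \<in> S \<Longrightarrow> \<bar>f x\<bar> \<le> \<theta> * \<bar>f (g x)\<bar> + K"
    and \<theta>: "0 \<le> \<theta>" "\<theta> < 1" and x: "x \<in> S"
  shows "\<bar>f x\<bar> \<le> K / (1 - \<theta>)"
proof -
  define s where "s = (SUP y\<in>S. \<bar>f y\<bar>)"
  have bd: "bdd_above ((\<lambda>y. \<bar>f y\<bar>) ` S)"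
    using bdd by (auto intro!: bdd_aboveI)
  have le: "\<bar>f y\<bar> \<le> s" if "y \<in> S" for y
    unfolding s_def by (rule cSUP_upper[OF that bd])
  have "s \<le> \<theta> * s + K"
    unfolding s_def
  proof (rule cSUP_least)
    show "S \<noteq> {}" using x by auto
    fix y assume y: "y \<in> S"
    have "\<theta> * \<bar>f (g y)\<bar> \<le> \<theta> * s"
      using le[OF inv[OF y]] \<theta> by (intro mult_left_mono) auto
    then show "\<bar>f y\<bar> \<le> \<theta> * (SUP y\<in>S. \<bar>f y\<bar>) + K"
      using rec[OF y] unfolding s_def by linarith
  qed
  then have "s \<le> K / (1 - \<theta>)"
    using \<theta> by (simp add: field_simps)
  then show ?thesis using le[OF x] by linarith
qed

text \<open>The interval is cut into steps of length \<delta>. There are at most (y - x) / \<delta>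
  + 1 of them, each costing A: one A stays as a constant, the others are charged to the
  length.\<close>

lemma subadditive_interval_bound:
  fixes W :: "real \<Rightarrow> real \<Rightarrow> real"
  assumes sub: "\<And>x y z. lo \<le> x \<Longrightarrow> x \<le> y \<Longrightarrow> y \<le> z \<Longrightarrow> z \<le> hi \<Longrightarrow> W x z \<le> W x y + W y z"
    and short: "\<And>x y. lo \<le> x \<Longrightarrow> x \<le> y \<Longrightarrow> y \<le> hi \<Longrightarrow> y - x \<le> \<delta> \<Longrightarrow> W x y \<le> A + B * (y - x)"
    and "0 < \<delta>" "0 \<le> A" and xy: "lo \<le> x" "x \<le> y" "y \<le> hi"
  shows "W x y \<le> A + (B + A / \<delta>) * (y - x)"
proof -
  have "W x y \<le> A + (B + A / \<delta>) * (y - x)"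
    if "lo \<le> x" "x \<le> y" "y \<le> hi" "y - x \<le> real n * \<delta>" for n x y
    using that
  proof (induction n arbitrary: x)
    case 0
    then have "W x y \<le> A + B * (y - x)" "y = x" using short[of x y] \<open>0 < \<delta>\<close> by auto
    then show ?case by simp
  next
    case (Suc n)
    show ?case
    proof (cases "y - x \<le> \<delta>")
      case True
      have "0 \<le> A / \<delta> * (y - x)" using assms(3,4) Suc.prems by simp
      then show ?thesis using short[of x y] Suc.prems True by (simp add: algebra_simps)
    next
      case False
      have "W (x + \<delta>) y \<le> A + (B + A / \<delta>) * (y - (x + \<delta>))"
        using Suc.prems False \<open>0 < \<delta>\<close> by (intro Suc.IH) (auto simp: algebra_simps)
      moreover have "W x (x + \<delta>) \<le> A + B * \<delta>"
        using short[of x "x + \<delta>"] Suc.prems False \<open>0 < \<delta>\<close> by auto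
      moreover have "W x y \<le> W x (x + \<delta>) + W (x + \<delta>) y"
        using sub[of x "x + \<delta>" y] Suc.prems False \<open>0 < \<delta>\<close> by auto
      ultimately have "W x y \<le> A + B * \<delta> + (A + (B + A / \<delta>) * (y - (x + \<delta>)))"
        by linarith
      also have "\<dots> = A + (B + A / \<delta>) * (y - x)" using \<open>0 < \<delta>\<close> by (simp add: field_simps)
      finally show ?thesis .
    qed
  qed
  moreover obtain n :: nat where "y - x \<le> real n * \<delta>"
    using reals_Archimedean3[OF \<open>0 < \<delta>\<close>] by (meson less_imp_le)
  ultimately show ?thesis using xy by blast
qed

section \<open>Weak convergence to zero tested on half-lines\<close>

text \<open>In the splitting G = (G - g m) + g m the first part contributes at most K + 1 times the
  L1 distance of G and g m, uniformly in i. So m can be fixed before i tends to infinity.\<close>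

lemma integral_tendsto_zero_dominated:
  fixes F :: "nat \<Rightarrow> 'a \<Rightarrow> real" and g :: "nat \<Rightarrow> 'a \<Rightarrow> real"
  assumes F [measurable]: "\<And>i. F i \<in> borel_measurable M" and K: "\<And>i x. \<bar>F i x\<bar> \<le> K"
    and g: "\<And>m. integrable M (g m)" and w: "integrable M w" and gw: "\<And>m x. \<bar>g m x\<bar> \<le> w x"
    and lim: "\<And>x. x \<in> space M \<Longrightarrow> (\<lambda>m. g m x) \<longlonglongrightarrow> G x"
    and null: "\<And>m. (\<lambda>i. \<integral>x. g m x * F i x \<partial>M) \<longlonglongrightarrow> 0"
  shows "(\<lambda>i. \<integral>x. G x * F i x \<partial>M) \<longlonglongrightarrow> 0"
proof (cases "space M = {}")
  case True
  then have "(\<lambda>i. \<integral>x. G x * F i x \<partial>M) = (\<lambda>i. 0)"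
    by (intro ext) (simp add: Bochner_Integration.integral_empty)
  then show ?thesis by simp
next
  case False
  then obtain x0 where "x0 \<in> space M" by blast
  have "0 \<le> K" using K[of 0 x0] by linarith
  have [measurable]: "g m \<in> borel_measurable M" for m using g by (rule borel_measurable_integrable)
  have Gm [measurable]: "G \<in> borel_measurable M" by (rule borel_measurable_LIMSEQ_real[OF lim]) auto
  have Gw: "\<bar>G x\<bar> \<le> w x" if "x \<in> space M" for x
    by (rule LIMSEQ_le_const2[OF lim[OF that, THEN tendsto_rabs]]) (use gw in auto)
  have Gi: "integrable M G" by (rule Bochner_Integration.integrable_bound[OF w]) (use Gw in \<open>auto intro!: AE_I2 order_trans[OF Gw]\<close>)
  have L1: "(\<lambda>m. \<integral>x. \<bar>G x - g m x\<bar> \<partial>M) \<longlonglongrightarrow> (\<integral>x. 0 \<partial>M)"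
  proof (rule integral_dominated_convergence[where w="\<lambda>x. 2 * w x"])
    show "AE x in M. (\<lambda>m. \<bar>G x - g m x\<bar>) \<longlonglongrightarrow> 0"
      by (intro AE_I2 tendsto_rabs_zero) (use lim in \<open>auto intro!: tendsto_eq_intros\<close>)
    fix m
    have "\<bar>G x - g m x\<bar> \<le> 2 * w x" if "x \<in> space M" for x
      using Gw[OF that] gw[of m x] by linarith
    then show "AE x in M. norm \<bar>G x - g m x\<bar> \<le> 2 * w x" by (auto intro!: AE_I2)
  qed (use w in auto)
  have int: "integrable M (\<lambda>x. h x * F i x)" if "integrable M h" for h i
  proof (rule Bochner_Integration.integrable_bound[of _ "\<lambda>x. h x * K"])
    show "AE x in M. norm (h x * F i x) \<le> norm (h x * K)"
      using K[of i] \<open>0 \<le> K\<close> by (auto simp: abs_mult intro!: mult_left_mono)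
  qed (use that borel_measurable_integrable[OF that] in auto)
  show ?thesis
  proof (rule LIMSEQ_I)
    fix \<epsilon> :: real assume "0 < \<epsilon>"
    then have "0 < \<epsilon> / (2 * (K + 1))" using \<open>0 \<le> K\<close> by simp
    then obtain m where m: "\<bar>\<integral>x. \<bar>G x - g m x\<bar> \<partial>M\<bar> < \<epsilon> / (2 * (K + 1))"
      using LIMSEQ_D[OF L1] by fastforce
    obtain N where N: "\<And>i. N \<le> i \<Longrightarrow> \<bar>\<integral>x. g m x * F i x \<partial>M\<bar> < \<epsilon> / 2"
      using LIMSEQ_D[OF null[of m], of "\<epsilon> / 2"] \<open>0 < \<epsilon>\<close> by auto
    have "\<bar>\<integral>x. G x * F i x \<partial>M\<bar> < \<epsilon>" if "N \<le> i" for i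
    proof -
      have "(\<integral>x. G x * F i x \<partial>M) = (\<integral>x. (G x - g m x) * F i x \<partial>M) + (\<integral>x. g m x * F i x \<partial>M)"
        using int[OF Gi, of i] int[OF g, of m i]
        by (subst Bochner_Integration.integral_add[symmetric]) (auto simp: algebra_simps)
      moreover have "\<bar>\<integral>x. (G x - g m x) * F i x \<partial>M\<bar> \<le> (\<integral>x. \<bar>(G x - g m x) * F i x\<bar> \<partial>M)"
        by (rule integral_abs_bound)
      moreover have "\<dots> \<le> (\<integral>x. \<bar>G x - g m x\<bar> * (K + 1) \<partial>M)"
      proof (rule integral_mono)
        show "integrable M (\<lambda>x. \<bar>(G x - g m x) * F i x\<bar>)"
          using int[OF Bochner_Integration.integrable_diff[OF Gi g], of m i] by auto
        show "integrable M (\<lambda>x. \<bar>G x - g m x\<bar> * (K + 1))" using Gi g by auto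
        show "\<bar>(G x - g m x) * F i x\<bar> \<le> \<bar>G x - g m x\<bar> * (K + 1)" for x
          unfolding abs_mult using K[of i x] by (intro mult_left_mono) auto
      qed
      moreover have "(\<integral>x. \<bar>G x - g m x\<bar> * (K + 1) \<partial>M) < \<epsilon> / 2"
        using m \<open>0 \<le> K\<close> unfolding integral_mult_left_zero by (simp add: field_simps)
      ultimately show ?thesis using N[OF that] by linarith
    qed
    then show "\<exists>N. \<forall>i\<ge>N. norm ((\<integral>x. G x * F i x \<partial>M) - 0) < \<epsilon>" by auto
  qed
qed

lemma integrable_indicator_Icc [simp]:
  fixes c d :: real
  shows "integrable lborel (indicator {c..d} :: real \<Rightarrow> real)"
  by (rule integrable_real_indicator) (auto simp: emeasure_lborel_Icc_eq)

text \<open>Half-lines are stable under intersection, so the limit passes to Borel sets by Dynkin's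
  theorem, and then to integrable g through simple functions and dominated limits. The common
  support keeps complements and countable unions within finite measure.\<close>

lemma integral_tendsto_zero_of_intervals:
  fixes F :: "nat \<Rightarrow> real \<Rightarrow> real" and g :: "real \<Rightarrow> real"
  assumes F [measurable]: "\<And>i. F i \<in> borel_measurable borel" and K: "\<And>i x. \<bar>F i x\<bar> \<le> K"
    and supp: "\<And>i x. x \<notin> {l..u} \<Longrightarrow> F i x = 0"
    and null: "\<And>y. (\<lambda>i. \<integral>x. indicator {..y} x * F i x \<partial>lborel) \<longlonglongrightarrow> 0"
    and g: "integrable lborel g"
  shows "(\<lambda>i. \<integral>x. g x * F i x \<partial>lborel) \<longlonglongrightarrow> 0"
proof -
  have ind: "integrable lborel (indicator {l..u} :: real \<Rightarrow> real)" by simp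
  have int: "integrable lborel (\<lambda>x. indicator A x * F i x)" if [measurable]: "A \<in> sets borel" for A i
  proof (rule Bochner_Integration.integrable_bound[of _ "\<lambda>x. indicator {l..u} x * K"])
    show "AE x in lborel. norm (indicator A x * F i x) \<le> norm (indicator {l..u} x * K)"
    proof (rule AE_I2)
      fix x
      show "norm (indicator A x * F i x) \<le> norm (indicator {l..u} x * K)"
        using supp[of x i] K[of i x] by (cases "x \<in> {l..u}") (auto simp: indicator_def)
    qed
  qed (use ind in auto)
  have sets: "(\<lambda>i. \<integral>x. indicator A x * F i x \<partial>lborel) \<longlonglongrightarrow> 0" if "A \<in> sets borel" for A
  proof -
    have eq: "sets borel = sigma_sets UNIV (range (\<lambda>y::real. {..y}))"
      unfolding borel_eq_atMost by (simp add: sets_measure_of)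
    have "Int_stable (range (\<lambda>y::real. {..y}))" by (auto simp: Int_stable_def)
    moreover have "range (\<lambda>y::real. {..y}) \<subseteq> Pow UNIV" by simp
    ultimately show ?thesis using that[unfolded eq]
    proof (induction rule: sigma_sets_induct_disjoint)
      case (basic A)
      then show ?case using null by auto
    next
      case empty
      then show ?case by simp
    next
      case (compl A)
      have [measurable]: "A \<in> sets borel" using compl(1) unfolding eq .
      \<comment> \<open>\<open>{..u}\<close> stands for the whole line, as F i vanishes outside
        \<open>{l..u}\<close>.\<close>
      have "(\<lambda>i. (\<integral>x. indicator {..u} x * F i x \<partial>lborel) - (\<integral>x. indicator A x * F i x \<partial>lborel)) \<longlonglongrightarrow> 0 - 0"
        by (intro tendsto_diff null compl)
      moreover have "(\<integral>x. indicator (UNIV - A) x * F i x \<partial>lborel)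
          = (\<integral>x. indicator {..u} x * F i x \<partial>lborel) - (\<integral>x. indicator A x * F i x \<partial>lborel)" for i
      proof -
        have "(\<integral>x. indicator (UNIV - A) x * F i x \<partial>lborel)
            = (\<integral>x. indicator {..u} x * F i x - indicator A x * F i x \<partial>lborel)"
          by (intro Bochner_Integration.integral_cong) (auto simp: indicator_def supp)
        also have "\<dots> = (\<integral>x. indicator {..u} x * F i x \<partial>lborel) - (\<integral>x. indicator A x * F i x \<partial>lborel)"
          by (rule Bochner_Integration.integral_diff[OF int int]) measurable
        finally show ?thesis .
      qed
      ultimately show ?case by simp
    next
      case (union A)
      then have [measurable]: "A j \<in> sets borel" for j unfolding eq by auto
      have "(\<lambda>i. \<integral>x. (indicator (\<Union>j. A j) x * indicator {l..u} x) * F i x \<partial>lborel) \<longlonglongrightarrow> 0"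
      proof (rule integral_tendsto_zero_dominated[where K=K and w="indicator {l..u}"
            and g="\<lambda>m x. indicator (\<Union>j<m. A j) x * indicator {l..u} x"])
        show "(\<lambda>m. indicator (\<Union>j<m. A j) x * indicator {l..u} x) \<longlonglongrightarrow> indicator (\<Union>j. A j) x * (indicator {l..u} x :: real)" for x
          by (intro tendsto_mult_right LIMSEQ_indicator_UN)
        show "integrable lborel (\<lambda>x. indicator (\<Union>j<m. A j) x * indicator {l..u} x :: real)" for m
          by (rule Bochner_Integration.integrable_bound[OF ind]) (auto simp: indicator_def)
        show "\<bar>indicator (\<Union>j<m. A j) x * indicator {l..u} x\<bar> \<le> (indicator {l..u} x :: real)" for m x
          by (auto simp: indicator_def)
        fix m
        have pt: "(indicator (\<Union>j<m. A j) x * indicator {l..u} x) * F i x = (\<Sum>j<m. indicator (A j) x * F i x)" for x i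
        proof -
          have "indicator (\<Union>j<m. A j) x = (\<Sum>j<m. indicator (A j) x :: real)"
            using union(1) by (intro indicator_UN_disjoint) (auto simp: disjoint_family_on_def)
          then show ?thesis using supp[of x i] by (cases "x \<in> {l..u}") (simp_all add: sum_distrib_right)
        qed
        have "(\<integral>x. (indicator (\<Union>j<m. A j) x * indicator {l..u} x) * F i x \<partial>lborel)
            = (\<Sum>j<m. \<integral>x. indicator (A j) x * F i x \<partial>lborel)" for i
          unfolding pt by (rule Bochner_Integration.integral_sum) (rule int, measurable)
        then show "(\<lambda>i. \<integral>x. (indicator (\<Union>j<m. A j) x * indicator {l..u} x) * F i x \<partial>lborel) \<longlonglongrightarrow> 0"
          using union(3) by (simp add: tendsto_null_sum)
      qed (use K ind in auto)
      moreover have "(indicator (\<Union>j. A j) x * indicator {l..u} x) * F i x = indicator (\<Union>j. A j) x * F i x" for x i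
        using supp[of x i] by (cases "x \<in> {l..u}") auto
      ultimately show ?case by simp
    qed
  qed
  from g show ?thesis
  proof (induction rule: integrable_induct)
    case (base A c)
    then have "A \<in> sets borel" by simp
    from tendsto_mult_left[OF sets[OF this], of c] show ?case by (simp add: mult_ac)
  next
    case (add f g)
    have int: "integrable lborel (\<lambda>x. h x * F i x)" if "integrable lborel h" for h i
    proof (rule Bochner_Integration.integrable_bound[of _ "\<lambda>x. h x * K"])
      show "AE x in lborel. norm (h x * F i x) \<le> norm (h x * K)"
        using K[of i] by (auto simp: abs_mult intro!: mult_left_mono order_trans[OF K])
    qed (use that borel_measurable_integrable[OF that] in auto)
    show ?case
      using tendsto_add[OF add(3,4)] int[OF add(1)] int[OF add(2)] by (simp add: distrib_right)
  next
    case (lim f s)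
    show ?case
    proof (rule integral_tendsto_zero_dominated[where K=K and w="\<lambda>x. 2 * \<bar>f x\<bar>" and g=s])
      show "\<bar>s m x\<bar> \<le> 2 * \<bar>f x\<bar>" for m x using lim(3)[of x m] by simp
    qed (use lim K in auto)
  qed
qed

section \<open>Halving arguments and quadratic errors\<close>

text \<open>The bound M improves to |M| / 2^n for every n. In the applications S consists of pairs
  of points, and \<open>half\<close> uses the current bound e at the image of a pair under an
  iterate.\<close>

lemma halving_nonpos:
  fixes f :: "'a \<Rightarrow> real"
  assumes M: "\<And>x. x \<in> S \<Longrightarrow> f x \<le> M"
    and half: "\<And>e x. 0 \<le> e \<Longrightarrow> (\<And>y. y \<in> S \<Longrightarrow> f y \<le> e) \<Longrightarrow> x \<in> S \<Longrightarrow> f x \<le> e / 2"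
    and x: "x \<in> S"
  shows "f x \<le> 0"
proof -
  have "f y \<le> \<bar>M\<bar> * (1/2) ^ n" if "y \<in> S" for n y
    using that
  proof (induction n arbitrary: y)
    case 0
    then show ?case using M[of y] by simp
  next
    case (Suc n)
    then show ?case using half[of "\<bar>M\<bar> * (1/2) ^ n" y] by simp
  qed
  then have "\<exists>N. \<forall>n\<ge>N. f x \<le> \<bar>M\<bar> * (1/2) ^ n" using x by blast
  moreover have "(\<lambda>n. \<bar>M\<bar> * (1/2) ^ n) \<longlonglongrightarrow> 0"
    by (intro tendsto_mult_right_zero LIMSEQ_realpow_zero) auto
  ultimately show ?thesis by (intro LIMSEQ_le_const)
qed

text \<open>The error is quadratic in the joint increment of x and \<psi>, as an implicit equation
  delivers it, not in x - a alone. Continuity makes K times the joint increment less than 1/2, which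
  shows \<psi> to be Lipschitz at a; only then is the error of order (x - a)^2.\<close>

lemma has_derivative_quadratic_error:
  fixes \<psi> :: "real \<Rightarrow> real"
  assumes cont: "(\<psi> \<longlongrightarrow> \<psi> a) (at a)"
    and err: "\<forall>\<^sub>F x in at a. \<bar>\<psi> x - \<psi> a - D * (x - a)\<bar> \<le> K * (\<bar>\<psi> x - \<psi> a\<bar> + \<bar>x - a\<bar>)\<^sup>2"
  shows "(\<psi> has_real_derivative D) (at a)"
proof -
  define K' where "K' = \<bar>K\<bar> + 1"
  define c where "c = 2 * \<bar>D\<bar> + 2"
  have "((\<lambda>x. K' * (\<bar>\<psi> x - \<psi> a\<bar> + \<bar>x - a\<bar>)) \<longlongrightarrow> 0) (at a)"
    using cont by (auto intro!: tendsto_eq_intros)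
  then have "\<forall>\<^sub>F x in at a. K' * (\<bar>\<psi> x - \<psi> a\<bar> + \<bar>x - a\<bar>) < 1 / 2"
    by (rule order_tendstoD(2)) simp
  then have ev: "\<forall>\<^sub>F x in at a. norm ((\<psi> x - \<psi> a) / (x - a) - D) \<le> K' * c\<^sup>2 * \<bar>x - a\<bar>"
    using err eventually_neq_at_within[of a a UNIV]
  proof (eventually_elim)
    case (elim x)
    define u t where "u = \<bar>\<psi> x - \<psi> a\<bar>" and "t = \<bar>x - a\<bar>"
    have "x \<noteq> a" using elim by simp
    have "0 \<le> u" "0 < t" using \<open>x \<noteq> a\<close> by (simp_all add: u_def t_def)
    have E: "\<bar>\<psi> x - \<psi> a - D * (x - a)\<bar> \<le> K' * (u + t)\<^sup>2"
    proof -
      have "K * (u + t)\<^sup>2 \<le> K' * (u + t)\<^sup>2"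
        unfolding K'_def by (rule mult_right_mono) simp_all
      then show ?thesis using elim(2) unfolding u_def t_def by linarith
    qed
    also have "\<dots> = (K' * (u + t)) * (u + t)" by (simp add: power2_eq_square)
    also have "\<dots> \<le> (1 / 2) * (u + t)"
      using elim(1) \<open>0 \<le> u\<close> \<open>0 < t\<close> unfolding u_def t_def by (intro mult_right_mono) auto
    finally have "\<bar>\<psi> x - \<psi> a - D * (x - a)\<bar> \<le> (1 / 2) * (u + t)" .
    moreover have "u \<le> \<bar>\<psi> x - \<psi> a - D * (x - a)\<bar> + \<bar>D\<bar> * t"
      unfolding u_def t_def abs_mult[symmetric] by linarith
    \<comment> \<open>From u \<le> (u + t) / 2 + |D| * t follows u \<le> (1 + 2 * |D|) * t, hence
      the value of \<open>c\<close>.\<close>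
    ultimately have "u + t \<le> c * t" unfolding c_def by (simp add: algebra_simps)
    then have "(u + t)\<^sup>2 \<le> (c * t)\<^sup>2" using \<open>0 \<le> u\<close> \<open>0 < t\<close> by (intro power_mono) auto
    then have "K' * (u + t)\<^sup>2 \<le> K' * (c * t)\<^sup>2" by (intro mult_left_mono) (simp_all add: K'_def)
    with E have "\<bar>\<psi> x - \<psi> a - D * (x - a)\<bar> \<le> K' * c\<^sup>2 * t * t"
      by (simp add: power2_eq_square mult_ac)
    moreover have "(\<psi> x - \<psi> a) / (x - a) - D = (\<psi> x - \<psi> a - D * (x - a)) / (x - a)"
      using \<open>x \<noteq> a\<close> by (simp add: field_simps)
    ultimately show ?case
      using \<open>0 < t\<close> by (simp add: abs_divide t_def[symmetric] divide_le_eq)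
  qed
  have "((\<lambda>x. K' * c\<^sup>2 * \<bar>x - a\<bar>) \<longlongrightarrow> 0) (at a)"
    by (auto intro!: tendsto_eq_intros)
  then have "((\<lambda>x. (\<psi> x - \<psi> a) / (x - a) - D) \<longlongrightarrow> 0) (at a)"
    by (rule Lim_null_comparison[OF ev])
  then show ?thesis
    unfolding has_field_derivative_iff by (rule LIM_zero_cancel)
qed

section \<open>Recovering symbols from kneading sequences\<close>

lemma kneading_cases:
  obtains (inf) "\<And>n. 1 \<le> n \<Longrightarrow> ext_kneading a b n \<noteq> C" "kneading a b = Inf (\<lambda>n. ext_kneading a b (Suc n))"
  | (fin) k where "1 \<le> k" "ext_kneading a b k = C" "kneading a b = Fin (map (ext_kneading a b) [1..<Suc k])"
proof (cases "\<forall>n\<ge>1. ext_kneading a b n \<noteq> C")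
  case True
  then have "kneading a b = Inf (\<lambda>n. ext_kneading a b (Suc n))"
    unfolding kneading_def by (rule if_P)
  then show ?thesis by (rule inf[rotated]) (simp add: True)
next
  case False
  define k where "k = (LEAST n. n \<ge> 1 \<and> ext_kneading a b n = C)"
  have "k \<ge> 1 \<and> ext_kneading a b k = C"
    unfolding k_def by (rule LeastI_ex) (use False in simp)
  moreover have "kneading a b = Fin (map (ext_kneading a b) [1..<Suc k])"
    unfolding kneading_def k_def Let_def using False by (rule if_not_P)
  ultimately show ?thesis by (intro fin[of k]) simp_all
qed

text \<open>A finite kneading sequence says nothing beyond its final C, so symbols are compared only
  up to and including the first C.\<close>

lemma kneading_eq_prefix:
  assumes eq: "kneading a b = kneading a' b'" and "1 \<le> n"
    and noC: "\<And>j. 1 \<le> j \<Longrightarrow> j < n \<Longrightarrow> ext_kneading a b j \<noteq> C"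
  shows "ext_kneading a' b' n = ext_kneading a b n"
proof (cases rule: kneading_cases[of a b])
  case inf
  show ?thesis
  proof (cases rule: kneading_cases[of a' b'])
    case inf': inf
    have "(\<lambda>n. ext_kneading a b (Suc n)) = (\<lambda>n. ext_kneading a' b' (Suc n))"
      using eq unfolding inf(2) inf'(2) by (rule kseq.inject(2)[THEN iffD1])
    from fun_cong[OF this, of "n - 1"] show ?thesis using \<open>1 \<le> n\<close> by simp
  next
    case fin
    then show ?thesis using eq inf(2) by simp
  qed
next
  case (fin k)
  show ?thesis
  proof (cases rule: kneading_cases[of a' b'])
    case inf
    then show ?thesis using eq fin(3) by simp
  next
    case fin': (fin k')
    have m: "map (ext_kneading a b) [1..<Suc k] = map (ext_kneading a' b') [1..<Suc k']"
      using eq unfolding fin(3) fin'(3) by (rule kseq.inject(1)[THEN iffD1])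
    have "k = k'" using arg_cong[OF m, of length] by (simp del: upt_Suc)
    have "\<not> k < n" using noC[OF fin(1)] fin(2) by blast
    then have "n \<in> set [1..<Suc k]" using \<open>1 \<le> n\<close> by (simp only: set_upt atLeastLessThan_iff not_less less_Suc_eq_le)
    moreover have "\<forall>x\<in>set [1..<Suc k]. ext_kneading a b x = ext_kneading a' b' x"
      using m[folded \<open>k = k'\<close>] unfolding map_eq_conv .
    ultimately show ?thesis by (simp only:)
  qed
qed

section \<open>The map at a fixed base parameter\<close>

locale skew_tent_map =
  fixes a b :: real
  assumes in_U: "(a, b) \<in> U_region"
begin

abbreviation T :: "real \<Rightarrow> real" where "T \<equiv> skew_tent a b"

definition p :: real where "p = b / a"
definition q :: real where "q = b / (1 - a)"
definition r :: real where "r = min p q"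

lemma parameters: "0 < a" "a < 1" "1/2 < b" "b \<le> 1" "a < b" "1 - a < b"
  using in_U by (auto simp: U_region_def)

lemma slopes: "1 < p" "1 < q" "1 < r" "r \<le> p" "r \<le> q" "0 < p" "0 < q"
  using parameters by (auto simp: p_def q_def r_def)

lemma T_left: "x \<le> a \<Longrightarrow> T x = b + p * (x - a)"
  using parameters by (simp add: skew_tent_def p_def field_simps)

lemma T_right: "a \<le> x \<Longrightarrow> T x = b - q * (x - a)"
  using parameters by (auto simp: skew_tent_def q_def field_simps)

lemma T_turning [simp]: "T a = b"
  by (simp add: T_left)

lemma T_unit: assumes "x \<in> {0..1}" shows "T x \<in> {0..1}"
proof (cases "x \<le> a")
  case True
  then have "p * (x - a) \<le> 0" "p * x \<ge> 0" "p * a = b"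
    using slopes parameters assms by (auto simp: mult_le_0_iff) (simp add: p_def)
  then show ?thesis using parameters T_left[OF True] by (simp add: algebra_simps)
next
  case False
  then have "q * (x - a) \<ge> 0" "q * (1 - x) \<ge> 0" "q * (1 - a) = b"
    using slopes parameters assms by (auto simp: q_def)
  then show ?thesis using parameters T_right[of x] False by (simp add: algebra_simps)
qed

lemma funpow_T_unit: "x \<in> {0..1} \<Longrightarrow> (T ^^ n) x \<in> {0..1}"
  by (induction n) (use T_unit in auto)

lemma turning_unit: "a \<in> {0..1}" "b \<in> {0..1}" "0 \<in> {0..1::real}" "1 \<in> {0..1::real}"
  using parameters by auto

lemma T_lipschitz: "\<bar>T x - T y\<bar> \<le> (p + q) * \<bar>x - y\<bar>"
proof -
  have L: "p * \<bar>x - y\<bar> \<le> (p + q) * \<bar>x - y\<bar>" and R: "q * \<bar>x - y\<bar> \<le> (p + q) * \<bar>x - y\<bar>" for x y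
    using slopes by (intro mult_right_mono; simp)+
  have same: "\<bar>T x - T y\<bar> \<le> (p + q) * \<bar>x - y\<bar>"
    if "(x \<le> a \<and> y \<le> a) \<or> (a \<le> x \<and> a \<le> y)" for x y
  proof -
    have "T x - T y = p * (x - y) \<or> T x - T y = - (q * (x - y))"
      using that by (auto simp: T_left T_right right_diff_distrib)
    then have "\<bar>T x - T y\<bar> = p * \<bar>x - y\<bar> \<or> \<bar>T x - T y\<bar> = q * \<bar>x - y\<bar>"
      using slopes by (auto simp: abs_mult)
    then show ?thesis using L[of x y] R[of x y] by auto
  qed
  have opp: "\<bar>T x - T y\<bar> \<le> (p + q) * \<bar>x - y\<bar>" if "x \<le> a" "a \<le> y" for x y
  proof -
    have "\<bar>T x - T y\<bar> \<le> \<bar>T x - T a\<bar> + \<bar>T a - T y\<bar>" by linarith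
    also have "\<dots> \<le> (p + q) * \<bar>x - a\<bar> + (p + q) * \<bar>a - y\<bar>"
      using that by (intro add_mono same) auto
    also have "\<dots> = (p + q) * \<bar>x - y\<bar>" using that by (simp add: algebra_simps)
    finally show ?thesis .
  qed
  show ?thesis
  proof (cases "(x \<le> a \<and> y \<le> a) \<or> (a \<le> x \<and> a \<le> y)")
    case True then show ?thesis by (rule same)
  next
    case False
    then show ?thesis using opp[of x y] opp[of y x] by (auto simp: abs_minus_commute)
  qed
qed

lemma T_continuous: "isCont T x"
proof -
  have "(T \<longlongrightarrow> T x) (at x)"
  proof (rule metric_tendsto_imp_tendsto)
    show "((\<lambda>y. (p + q) * \<bar>y - x\<bar>) \<longlongrightarrow> 0) (at x)"
      by (auto intro!: tendsto_eq_intros)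
    show "\<forall>\<^sub>F y in at x. dist (T y) (T x) \<le> dist ((p + q) * \<bar>y - x\<bar>) 0"
      using T_lipschitz slopes by (auto simp: dist_real_def abs_mult)
  qed
  then show ?thesis by (simp add: isCont_def)
qed

lemma T_measurable [measurable]: "T \<in> borel_measurable borel"
  using T_continuous by (intro borel_measurable_continuous_onI) (auto simp: continuous_at_imp_continuous_on)

lemma funpow_T_measurable [measurable]: "(T ^^ n) \<in> borel_measurable borel"
  by (induction n) (auto intro: measurable_compose[OF _ T_measurable] simp: comp_def)

subsection \<open>Monotone pieces of the iterates\<close>

text \<open>Testing end points is enough: if both lie on one closed side of \<open>a\<close>, so
  does the interval between them, and its image is the interval between the images. Hence T^k is
  affine between x and y. Both sides contain \<open>a\<close>, so a good interval may end at the
  turning point.\<close>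

primrec good :: "nat \<Rightarrow> real \<Rightarrow> real \<Rightarrow> bool" where
  "good 0 x y = True"
| "good (Suc k) x y = (((x \<le> a \<and> y \<le> a) \<or> (a \<le> x \<and> a \<le> y)) \<and> good k (T x) (T y))"

lemma good_refl [simp]: "good k x x"
  by (induction k arbitrary: x) auto

text \<open>Only one-sided neighbourhoods are good in general, because an iterate may carry x to
  \<open>a\<close>. T maps a small one-sided neighbourhood of x into a one-sided neighbourhood of T
  x, also at the fold x = a, so the induction goes through.\<close>

lemma locally_good:
  "\<exists>\<eta>>0. \<forall>y z. ((y \<le> x \<and> z \<le> x) \<or> (x \<le> y \<and> x \<le> z)) \<longrightarrow> \<bar>y - x\<bar> < \<eta> \<longrightarrow> \<bar>z - x\<bar> < \<eta> \<longrightarrow> good k y z"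
proof (induction k arbitrary: x)
  case 0
  then show ?case by (auto intro: exI[of _ 1])
next
  case (Suc k)
  obtain \<eta> where \<eta>: "\<eta> > 0" and IH: "\<And>y z. ((y \<le> T x \<and> z \<le> T x) \<or> (T x \<le> y \<and> T x \<le> z)) \<Longrightarrow>
      \<bar>y - T x\<bar> < \<eta> \<Longrightarrow> \<bar>z - T x\<bar> < \<eta> \<Longrightarrow> good k y z"
    using Suc.IH[of "T x"] by blast
  \<comment> \<open>For x other than \<open>a\<close> the neighbourhood has to stay on one side of
    \<open>a\<close>. At x = a one-sidedness already ensures this, and 1 is arbitrary.\<close>
  define \<epsilon> where "\<epsilon> = min (\<eta> / (p + q)) (if x = a then 1 else \<bar>x - a\<bar>)"
  have "\<epsilon> > 0" using \<eta> slopes by (auto simp: \<epsilon>_def)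
  have near: "\<bar>T y - T x\<bar> < \<eta>" if "\<bar>y - x\<bar> < \<epsilon>" for y
  proof -
    have "\<bar>y - x\<bar> < \<eta> / (p + q)" using that by (simp add: \<epsilon>_def)
    then have "(p + q) * \<bar>y - x\<bar> < \<eta>" using slopes by (simp add: field_simps)
    then show ?thesis using T_lipschitz[of y x] by linarith
  qed
  have "good (Suc k) y z"
    if side: "(y \<le> x \<and> z \<le> x) \<or> (x \<le> y \<and> x \<le> z)" and yz: "\<bar>y - x\<bar> < \<epsilon>" "\<bar>z - x\<bar> < \<epsilon>" for y z
  proof -
    have ss: "(y \<le> a \<and> z \<le> a \<and> x \<le> a) \<or> (a \<le> y \<and> a \<le> z \<and> a \<le> x)"
      using side yz by (auto simp: \<epsilon>_def split: if_splits)
    have mono: "T u \<le> T t" if "u \<le> t" "t \<le> a" for u t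
      using that slopes by (auto simp: T_left)
    have anti: "T t \<le> T u" if "u \<le> t" "a \<le> u" for u t
      using that slopes by (auto simp: T_right)
    have "(T y \<le> T x \<and> T z \<le> T x) \<or> (T x \<le> T y \<and> T x \<le> T z)"
      using ss side mono anti by metis
    then show ?thesis using ss IH near[OF yz(1)] near[OF yz(2)] by auto
  qed
  then show ?case using \<open>\<epsilon> > 0\<close> by blast
qed

text \<open>\<delta> is a Lebesgue number of the cover by the balls of \<open>locally_good\<close>.
  A short interval lies in one ball and is cut at the centre if it contains it. So one cut suffices
  for every k; only \<delta> depends on k.\<close>

lemma short_interval_cut:
  obtains \<delta> where "\<delta> > 0"
    "\<And>x y. 0 \<le> x \<Longrightarrow> x \<le> y \<Longrightarrow> y \<le> 1 \<Longrightarrow> y - x < \<delta> \<Longrightarrow> \<exists>m. x \<le> m \<and> m \<le> y \<and> good k x m \<and> good k m y"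
proof -
  obtain \<eta> where \<eta>: "\<And>x. \<eta> x > 0"
    and g: "\<And>x y z. ((y \<le> x \<and> z \<le> x) \<or> (x \<le> y \<and> x \<le> z)) \<Longrightarrow> \<bar>y - x\<bar> < \<eta> x \<Longrightarrow> \<bar>z - x\<bar> < \<eta> x \<Longrightarrow> good k y z"
  proof -
    have "\<forall>x. \<exists>\<eta>>0. \<forall>y z. ((y \<le> x \<and> z \<le> x) \<or> (x \<le> y \<and> x \<le> z)) \<longrightarrow> \<bar>y - x\<bar> < \<eta> \<longrightarrow> \<bar>z - x\<bar> < \<eta> \<longrightarrow> good k y z"
      using locally_good by blast
    then show thesis using that unfolding choice_iff by blast
  qed
  obtain \<delta> where \<delta>: "\<delta> > 0"
    and cover: "\<And>x. x \<in> {0..1} \<Longrightarrow> \<exists>G\<in>range (\<lambda>x. ball x (\<eta> x)). ball x \<delta> \<subseteq> G"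
  proof (rule Heine_Borel_lemma[of "{0..1::real}" "range (\<lambda>x. ball x (\<eta> x))"])
    show "{0..1} \<subseteq> \<Union> (range (\<lambda>x. ball x (\<eta> x)))"
      using \<eta> by (auto intro: centre_in_ball[THEN iffD2])
  qed auto
  show thesis
  proof (rule that[OF \<delta>])
    fix x y :: real assume xy: "0 \<le> x" "x \<le> y" "y \<le> 1" "y - x < \<delta>"
    obtain z where "ball x \<delta> \<subseteq> ball z (\<eta> z)" using cover[of x] xy by auto
    then have "x \<in> ball z (\<eta> z)" "y \<in> ball z (\<eta> z)"
      using xy \<delta> by (auto simp: subset_iff dist_real_def)
    then have d: "\<bar>x - z\<bar> < \<eta> z" "\<bar>y - z\<bar> < \<eta> z" by (auto simp: dist_real_def abs_minus_commute)
    show "\<exists>m. x \<le> m \<and> m \<le> y \<and> good k x m \<and> good k m y"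
    proof (cases "x \<le> z \<and> z \<le> y")
      case True
      then show ?thesis using g[of x z z] g[of z z y] d \<eta>[of z] by (intro exI[of _ z]) auto
    next
      case False
      then have "good k x y" using g[of x z y] d xy by auto
      then show ?thesis using xy by (intro exI[of _ x]) auto
    qed
  qed
qed

section \<open>Pulling functions back along the branches\<close>

text \<open>Up to a constant, V' is V o T - V b divided by the signed slope of the branch. Working
  with increments discards additive constants, and since \<open>a\<close> belongs to both ranges,
  the two branches of V' are tied together there. P and Q may differ from the slopes of T: a
  semiconjugacy is its own pullback with the slopes of the other map.\<close>

definition pullback :: "real \<Rightarrow> real \<Rightarrow> (real \<Rightarrow> real) \<Rightarrow> (real \<Rightarrow> real) \<Rightarrow> bool" where
  "pullback P Q V V' \<longleftrightarrow>
     (\<forall>x\<in>{0..a}. \<forall>y\<in>{0..a}. V (T y) - V (T x) = P * (V' y - V' x)) \<and>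
     (\<forall>x\<in>{a..1}. \<forall>y\<in>{a..1}. V (T y) - V (T x) = - Q * (V' y - V' x))"

text \<open>For a good pair this is the product of the signed slopes along the common itinerary; for
  other pairs it has no such meaning.\<close>

primrec pair_slope :: "real \<Rightarrow> real \<Rightarrow> nat \<Rightarrow> real \<Rightarrow> real \<Rightarrow> real" where
  "pair_slope P Q 0 x y = 1"
| "pair_slope P Q (Suc k) x y = (if x \<le> a \<and> y \<le> a then P else - Q) * pair_slope P Q k (T x) (T y)"

lemma pair_slope_bound:
  assumes "\<rho> \<le> P" "\<rho> \<le> Q" "0 \<le> \<rho>"
  shows "\<rho> ^ k \<le> \<bar>pair_slope P Q k x y\<bar>"
proof (induction k arbitrary: x y)
  case (Suc k)
  have "\<rho> * \<rho> ^ k \<le> \<bar>if x \<le> a \<and> y \<le> a then P else - Q\<bar> * \<bar>pair_slope P Q k (T x) (T y)\<bar>"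
    using assms Suc.IH by (intro mult_mono) auto
  then show ?case by (simp add: abs_mult)
qed simp

text \<open>Signs flip at times determined by x and y only, whatever the positive slopes
  are.\<close>

lemma pair_slope_sign:
  assumes "0 < P" "0 < Q" "0 < P'" "0 < Q'"
  shows "0 < pair_slope P Q k x y * pair_slope P' Q' k x y"
proof (induction k arbitrary: x y)
  case (Suc k)
  have "0 < (P * P') * (pair_slope P Q k (T x) (T y) * pair_slope P' Q' k (T x) (T y))"
    "0 < (Q * Q') * (pair_slope P Q k (T x) (T y) * pair_slope P' Q' k (T x) (T y))"
    using Suc.IH[of "T x" "T y"] assms by (simp_all add: zero_less_mult_iff)
  then show ?case by (simp add: mult_ac)
qed simp

lemma pullback_good:
  assumes "\<And>n. pullback P Q (V n) (V (Suc n))" "good k x y" "x \<in> {0..1}" "y \<in> {0..1}"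
  shows "V n ((T ^^ k) y) - V n ((T ^^ k) x) = pair_slope P Q k x y * (V (n + k) y - V (n + k) x)"
  using assms(2-)
proof (induction k arbitrary: x y)
  case (Suc k)
  have "V n ((T ^^ Suc k) y) - V n ((T ^^ Suc k) x)
      = pair_slope P Q k (T x) (T y) * (V (n + k) (T y) - V (n + k) (T x))"
    using Suc T_unit unfolding funpow_Suc_right comp_def by simp
  also have "V (n + k) (T y) - V (n + k) (T x) = (if x \<le> a \<and> y \<le> a then P else - Q) * (V (n + Suc k) y - V (n + Suc k) x)"
    using assms(1)[of "n + k"] Suc.prems unfolding pullback_def by auto
  finally show ?case by simp
qed simp

lemma pullback_id: "pullback p q (\<lambda>x. x) (\<lambda>x. x)"
  unfolding pullback_def by (auto simp: T_left T_right algebra_simps)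

lemma T_good:
  assumes "good k x y" "x \<in> {0..1}" "y \<in> {0..1}"
  shows "(T ^^ k) y - (T ^^ k) x = pair_slope p q k x y * (y - x)"
  using pullback_good[of p q "\<lambda>_ x. x", OF pullback_id assms] by simp

text \<open>A Lasota--Yorke inequality: the part of the bound that does not shrink with the interval
  halves every \<open>k\<close> steps.\<close>
lemma pullback_bounded:
  assumes pb: "\<And>n. pullback p q (V n) (V (Suc n))"
    and M: "\<And>x. x \<in> {0..1} \<Longrightarrow> \<bar>V 0 x\<bar> \<le> M"
  obtains k B where "k > 0"
    "\<And>i x y. x \<in> {0..1} \<Longrightarrow> y \<in> {0..1} \<Longrightarrow> \<bar>V (i * k) y - V (i * k) x\<bar> \<le> B"
proof -
  \<comment> \<open>Two pieces of a cut, each contracted by more than 4, together give the factor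
    1/2.\<close>
  obtain k where "4 < r ^ k" using slopes real_arch_pow by blast
  then have "k > 0" by (cases k) auto
  obtain \<delta> where \<delta>: "\<delta> > 0" and cut: "\<And>x y. 0 \<le> x \<Longrightarrow> x \<le> y \<Longrightarrow> y \<le> 1 \<Longrightarrow> y - x < \<delta> \<Longrightarrow>
      \<exists>m. x \<le> m \<and> m \<le> y \<and> good k x m \<and> good k m y"
    using short_interval_cut[of k] by blast
  have "M \<ge> 0" using M[of 0] by auto
  \<comment> \<open>\<open>A i\<close> is the part of the bound that ignores the length,
    \<open>B i\<close> the Lipschitz part. Chaining steps of length \<delta> / 2 adds A (i + 1) /
    (\<delta> / 2) to the Lipschitz part, and these increments form a geometric series.\<close>
  define A where "A i = 2 * M * (1/2) ^ i" for i :: nat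
  define B where "B i = (2 * M / \<delta>) * 2 * (1 - (1/2) ^ i)" for i :: nat
  have A0: "A i \<ge> 0" for i using \<open>M \<ge> 0\<close> by (simp add: A_def)
  have ASuc: "A (Suc i) = A i / 2" for i by (simp add: A_def)
  have BSuc: "B (Suc i) = B i + A (Suc i) / (\<delta> / 2)" for i
    using \<delta> by (simp add: A_def B_def field_simps)
  have B0: "B i \<ge> 0" for i using \<open>M \<ge> 0\<close> \<delta> by (simp add: B_def power_le_one)
  have main: "\<bar>V (i * k) y - V (i * k) x\<bar> \<le> A i + B i * (y - x)"
    if "0 \<le> x" "x \<le> y" "y \<le> 1" for i x y
    using that
  proof (induction i arbitrary: x y)
    case 0
    then show ?case using M[of x] M[of y] by (simp add: A_def B_def)
  next
    case (Suc i)
    have good: "\<bar>V (Suc i * k) y - V (Suc i * k) x\<bar> \<le> A (Suc i) / 2 + B i * (y - x)"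
      if "good k x y" "0 \<le> x" "x \<le> y" "y \<le> 1" for x y
    proof -
      let ?S = "pair_slope p q k x y"
      have S: "4 < \<bar>?S\<bar>" using pair_slope_bound[of r p q k x y] slopes \<open>4 < r ^ k\<close> by linarith
      have "\<bar>V (i * k) ((T ^^ k) y) - V (i * k) ((T ^^ k) x)\<bar> \<le> A i + B i * \<bar>(T ^^ k) y - (T ^^ k) x\<bar>"
        using Suc.IH[of "(T ^^ k) x" "(T ^^ k) y"] Suc.IH[of "(T ^^ k) y" "(T ^^ k) x"]
          funpow_T_unit[of x k] funpow_T_unit[of y k] that
        by (cases "(T ^^ k) x \<le> (T ^^ k) y") (auto simp: abs_minus_commute)
      moreover have "V (i * k) ((T ^^ k) y) - V (i * k) ((T ^^ k) x) = ?S * (V (Suc i * k) y - V (Suc i * k) x)"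
        using pullback_good[of p q V k x y "i * k", OF pb] that by (simp add: add.commute)
      moreover have "(T ^^ k) y - (T ^^ k) x = ?S * (y - x)" using T_good[of k x y] that by simp
      \<comment> \<open>V and the identity are stretched by the same slope, so the Lipschitz part is
        inherited unchanged while the constant part is divided by the slope.\<close>
      ultimately have "\<bar>?S\<bar> * \<bar>V (Suc i * k) y - V (Suc i * k) x\<bar> \<le> A i + B i * (\<bar>?S\<bar> * (y - x))"
        using that by (simp add: abs_mult)
      then have "\<bar>V (Suc i * k) y - V (Suc i * k) x\<bar> \<le> A i / \<bar>?S\<bar> + B i * (y - x)"
        using S by (simp add: field_simps)
      moreover have "A i / \<bar>?S\<bar> \<le> A i / 4" using S A0[of i] by (intro divide_left_mono) auto
      ultimately show ?thesis using ASuc[of i] by linarith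
    qed
    show ?case
      unfolding BSuc
    proof (rule subadditive_interval_bound[where lo=0 and hi=1 and W="\<lambda>x y. \<bar>V (Suc i * k) y - V (Suc i * k) x\<bar>"])
      fix x y :: real assume xy: "0 \<le> x" "x \<le> y" "y \<le> 1" "y - x \<le> \<delta> / 2"
      then obtain m where m: "x \<le> m" "m \<le> y" "good k x m" "good k m y" using cut[of x y] \<delta> by auto
      have "\<bar>V (Suc i * k) y - V (Suc i * k) x\<bar> \<le> (A (Suc i) / 2 + B i * (m - x)) + (A (Suc i) / 2 + B i * (y - m))"
        using good[of x m] good[of m y] m xy by auto
      then show "\<bar>V (Suc i * k) y - V (Suc i * k) x\<bar> \<le> A (Suc i) + B i * (y - x)"
        by (simp add: algebra_simps)
    qed (use Suc.prems \<delta> A0 in auto)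
  qed
  have "\<bar>V (i * k) y - V (i * k) x\<bar> \<le> 2 * M + 2 * M / \<delta> * 2"
    if "x \<in> {0..1}" "y \<in> {0..1}" for i x y
  proof -
    have "A i + B i * \<bar>y - x\<bar> \<le> 2 * M + 2 * M / \<delta> * 2"
    proof (rule add_mono)
      show "A i \<le> 2 * M" using \<open>M \<ge> 0\<close> by (simp add: A_def mult_left_le power_le_one)
      have "B i \<le> 2 * M / \<delta> * 2"
        unfolding B_def using \<open>M \<ge> 0\<close> \<delta> by (intro mult_left_le) auto
      moreover have "B i * \<bar>y - x\<bar> \<le> B i * 1" using that B0[of i] by (intro mult_left_mono) auto
      ultimately show "B i * \<bar>y - x\<bar> \<le> 2 * M / \<delta> * 2" by linarith
    qed
    moreover have "\<bar>V (i * k) y - V (i * k) x\<bar> \<le> A i + B i * \<bar>y - x\<bar>"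
    proof (cases "x \<le> y")
      case True
      then show ?thesis using main[of x y i] that by simp
    next
      case False
      then show ?thesis using main[of y x i] that by (simp add: abs_minus_commute)
    qed
    ultimately show ?thesis by linarith
  qed
  then show thesis by (rule that[OF \<open>k > 0\<close>])
qed

subsection \<open>Twisted cohomological equations\<close>

text \<open>The series obtained by iterating u = f + w * (u o T); it converges to a bounded solution
  when f is bounded and |w| stays below a constant less than 1.\<close>

definition cocycle_sum :: "(real \<Rightarrow> real) \<Rightarrow> (real \<Rightarrow> real) \<Rightarrow> real \<Rightarrow> real" where
  "cocycle_sum w f x = (\<Sum>n. (\<Prod>j<n. w ((T ^^ j) x)) * f ((T ^^ n) x))"

lemma
  assumes w: "\<And>x. \<bar>w x\<bar> \<le> \<theta>" and \<theta>: "\<theta> < 1"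
    and f: "\<And>x. x \<in> {0..1} \<Longrightarrow> \<bar>f x\<bar> \<le> K" and x: "x \<in> {0..1}"
  shows cocycle_sum_step: "cocycle_sum w f x = f x + w x * cocycle_sum w f (T x)"
    and cocycle_sum_bound: "\<bar>cocycle_sum w f x\<bar> \<le> K / (1 - \<theta>)"
proof -
  have \<theta>0: "0 \<le> \<theta>" using w[of 0] by linarith
  have K0: "0 \<le> K" using f[OF x] by linarith
  have le: "\<bar>(\<Prod>j<n. w ((T ^^ j) y)) * f ((T ^^ n) y)\<bar> \<le> K * \<theta> ^ n" if "y \<in> {0..1}" for n y
  proof -
    have "\<bar>\<Prod>j<n. w ((T ^^ j) y)\<bar> \<le> (\<Prod>j<n. \<theta>)"
      unfolding abs_prod using w by (intro prod_mono) auto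
    then have "\<bar>\<Prod>j<n. w ((T ^^ j) y)\<bar> * \<bar>f ((T ^^ n) y)\<bar> \<le> \<theta> ^ n * K"
      using f[OF funpow_T_unit[OF that]] \<theta>0 by (intro mult_mono) auto
    then show ?thesis by (simp add: abs_mult mult.commute)
  qed
  have sg: "summable (\<lambda>n. K * \<theta> ^ n)" using \<theta> \<theta>0 by (intro summable_mult summable_geometric) auto
  have sm: "summable (\<lambda>n. (\<Prod>j<n. w ((T ^^ j) y)) * f ((T ^^ n) y))" if "y \<in> {0..1}" for y
    by (rule summable_comparison_test'[OF sg]) (use le[OF that] in auto)
  have shift: "(\<Prod>j<Suc n. w ((T ^^ j) x)) * f ((T ^^ Suc n) x)
      = w x * ((\<Prod>j<n. w ((T ^^ j) (T x))) * f ((T ^^ n) (T x)))" for n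
    by (simp only: prod.lessThan_Suc_shift funpow_Suc_right comp_apply funpow_0 mult.assoc)
  have "cocycle_sum w f x = f x + (\<Sum>n. (\<Prod>j<Suc n. w ((T ^^ j) x)) * f ((T ^^ Suc n) x))"
    unfolding cocycle_sum_def suminf_split_head[OF sm[OF x]] by simp
  also have "(\<Sum>n. (\<Prod>j<Suc n. w ((T ^^ j) x)) * f ((T ^^ Suc n) x)) = w x * cocycle_sum w f (T x)"
    unfolding shift cocycle_sum_def by (rule suminf_mult[OF sm[OF T_unit[OF x]]])
  finally show "cocycle_sum w f x = f x + w x * cocycle_sum w f (T x)" .
  have sa: "summable (\<lambda>n. \<bar>(\<Prod>j<n. w ((T ^^ j) x)) * f ((T ^^ n) x)\<bar>)"
    by (rule summable_comparison_test'[OF sg]) (use le[OF x] in simp)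
  have "\<bar>cocycle_sum w f x\<bar> \<le> (\<Sum>n. \<bar>(\<Prod>j<n. w ((T ^^ j) x)) * f ((T ^^ n) x)\<bar>)"
    unfolding cocycle_sum_def by (rule summable_rabs[OF sa])
  also have "\<dots> \<le> (\<Sum>n. K * \<theta> ^ n)"
    by (rule suminf_le[OF le[OF x] sa sg])
  also have "\<dots> = K * (1 / (1 - \<theta>))"
    using \<theta> \<theta>0 by (subst suminf_mult) (auto simp: suminf_geometric summable_geometric)
  finally show "\<bar>cocycle_sum w f x\<bar> \<le> K / (1 - \<theta>)" by simp
qed

text \<open>The inverse slope is set to \<open>0\<close> at the turning point, so that the equations below
  are consistent there with both branches.\<close>
definition inv_slope :: "real \<Rightarrow> real \<Rightarrow> real \<Rightarrow> real" where
  "inv_slope X Y x = (if x < a then X else if x = a then 0 else - Y)"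

text \<open>The candidate semiconjugacy from \<open>T\<close> to the tent map \<open>y \<mapsto> 1 + y / X\<close> for \<open>y \<le> 0\<close>,
  \<open>y \<mapsto> 1 - y / Y\<close> for \<open>y \<ge> 0\<close>; it is consistent at the turning point iff it maps \<open>b\<close> to \<open>1\<close>.\<close>
definition semiconj :: "real \<Rightarrow> real \<Rightarrow> real \<Rightarrow> real" where
  "semiconj X Y = cocycle_sum (inv_slope X Y) (\<lambda>x. - inv_slope X Y x)"

lemma inv_slope_bound: "\<bar>X\<bar> \<le> \<theta> \<Longrightarrow> \<bar>Y\<bar> \<le> \<theta> \<Longrightarrow> \<bar>inv_slope X Y x\<bar> \<le> \<theta>"
  by (auto simp: inv_slope_def)

lemma semiconj_step:
  assumes "\<bar>X\<bar> < 1" "\<bar>Y\<bar> < 1" "x \<in> {0..1}"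
  shows "semiconj X Y x = inv_slope X Y x * (semiconj X Y (T x) - 1)"
  using cocycle_sum_step[of "inv_slope X Y" "max \<bar>X\<bar> \<bar>Y\<bar>" "\<lambda>x. - inv_slope X Y x" 1 x]
    inv_slope_bound[of X "max \<bar>X\<bar> \<bar>Y\<bar>" Y] inv_slope_bound[of X 1 Y] assms
  unfolding semiconj_def by (simp add: algebra_simps)

lemma semiconj_bound:
  assumes "\<bar>X\<bar> \<le> \<theta>" "\<bar>Y\<bar> \<le> \<theta>" "\<theta> < 1" "x \<in> {0..1}"
  shows "\<bar>semiconj X Y x\<bar> \<le> 1 / (1 - \<theta>)"
  unfolding semiconj_def
proof (rule cocycle_sum_bound[OF _ assms(3) _ assms(4)])
  show "\<bar>inv_slope X Y x\<bar> \<le> \<theta>" for x using inv_slope_bound assms by auto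
  then show "\<bar>- inv_slope X Y x\<bar> \<le> 1" for x using assms(3) by (smt (verit))
qed

lemma semiconj_turning [simp]: "\<bar>X\<bar> < 1 \<Longrightarrow> \<bar>Y\<bar> < 1 \<Longrightarrow> semiconj X Y a = 0"
  using semiconj_step[of X Y a] parameters by (simp add: inv_slope_def)

text \<open>For x other than \<open>a\<close> this is \<open>semiconj_step\<close> solved for the
  value at T x. At x = a that equation reads 0 = 0, and the hypothesis on \<open>b\<close> supplies
  the case.\<close>

lemma semiconj_step_left:
  assumes "0 < X" "X < 1" "0 < Y" "Y < 1" "semiconj X Y b = 1" "0 \<le> x" "x \<le> a"
  shows "semiconj X Y (T x) = 1 + semiconj X Y x / X"
proof (cases "x = a")
  case False
  then show ?thesis using semiconj_step[of X Y x] assms parameters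
    by (simp add: inv_slope_def field_simps)
qed (use assms in simp)

lemma semiconj_step_right:
  assumes "0 < X" "X < 1" "0 < Y" "Y < 1" "semiconj X Y b = 1" "a \<le> x" "x \<le> 1"
  shows "semiconj X Y (T x) = 1 - semiconj X Y x / Y"
proof (cases "x = a")
  case False
  then show ?thesis using semiconj_step[of X Y x] assms parameters
    by (simp add: inv_slope_def field_simps)
qed (use assms in simp)

lemma semiconj_pullback:
  assumes "0 < X" "X < 1" "0 < Y" "Y < 1" "semiconj X Y b = 1"
  shows "pullback (1 / X) (1 / Y) (semiconj X Y) (semiconj X Y)"
proof -
  have "semiconj X Y (T y) - semiconj X Y (T x) = 1 / X * (semiconj X Y y - semiconj X Y x)"
    if "x \<in> {0..a}" "y \<in> {0..a}" for x y
    using that semiconj_step_left[OF assms, of x] semiconj_step_left[OF assms, of y]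
    by (simp add: diff_divide_distrib)
  moreover have "semiconj X Y (T y) - semiconj X Y (T x) = - (1 / Y) * (semiconj X Y y - semiconj X Y x)"
    if "x \<in> {a..1}" "y \<in> {a..1}" for x y
    using that semiconj_step_right[OF assms, of x] semiconj_step_right[OF assms, of y]
    by (simp add: diff_divide_distrib)
  ultimately show ?thesis unfolding pullback_def by blast
qed

text \<open>The difference of the two solutions satisfies a contracting equation with source (w -
  w') * (h' o T - 1), which is of the order of |X - X'| + |Y - Y'|.\<close>

lemma semiconj_lipschitz:
  assumes \<theta>: "\<bar>X\<bar> \<le> \<theta>" "\<bar>Y\<bar> \<le> \<theta>" "\<bar>X'\<bar> \<le> \<theta>" "\<bar>Y'\<bar> \<le> \<theta>" "\<theta> < 1" and x: "x \<in> {0..1}"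
  shows "\<bar>semiconj X Y x - semiconj X' Y' x\<bar> \<le> (\<bar>X - X'\<bar> + \<bar>Y - Y'\<bar>) * (1 + 1 / (1 - \<theta>)) / (1 - \<theta>)"
proof (rule contraction_bound[where S="{0..1}" and g=T and f="\<lambda>x. semiconj X Y x - semiconj X' Y' x", OF T_unit _ _ _ \<theta>(5) x])
  let ?B = "1 / (1 - \<theta>)"
  have b: "\<bar>semiconj X Y x\<bar> \<le> ?B" "\<bar>semiconj X' Y' x\<bar> \<le> ?B" if "x \<in> {0..1}" for x
    using semiconj_bound assms that by auto
  show "\<bar>semiconj X Y x - semiconj X' Y' x\<bar> \<le> 2 * ?B" if "x \<in> {0..1}" for x
    using b[OF that] by linarith
  show "0 \<le> \<theta>" using \<theta>(1) by linarith
  fix x :: real assume x: "x \<in> {0..1}"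
  have lt: "\<bar>X\<bar> < 1" "\<bar>Y\<bar> < 1" "\<bar>X'\<bar> < 1" "\<bar>Y'\<bar> < 1"
    using \<theta> by (meson le_less_trans)+
  let ?h = "semiconj X Y" and ?h' = "semiconj X' Y'" and ?w = "inv_slope X Y" and ?w' = "inv_slope X' Y'"
  have "?h x - ?h' x = ?w x * (?h (T x) - ?h' (T x)) + (?w x - ?w' x) * (?h' (T x) - 1)"
    unfolding semiconj_step[OF lt(1,2) x] semiconj_step[OF lt(3,4) x] by (simp add: algebra_simps)
  moreover have "\<bar>?w x * (?h (T x) - ?h' (T x))\<bar> \<le> \<theta> * \<bar>?h (T x) - ?h' (T x)\<bar>"
    unfolding abs_mult using inv_slope_bound[OF \<theta>(1,2)] by (intro mult_right_mono) auto
  moreover have "\<bar>(?w x - ?w' x) * (?h' (T x) - 1)\<bar> \<le> (\<bar>X - X'\<bar> + \<bar>Y - Y'\<bar>) * (1 + ?B)"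
    unfolding abs_mult
  proof (rule mult_mono)
    show "\<bar>?w x - ?w' x\<bar> \<le> \<bar>X - X'\<bar> + \<bar>Y - Y'\<bar>" by (auto simp: inv_slope_def)
    show "\<bar>?h' (T x) - 1\<bar> \<le> 1 + ?B" using b(2)[OF T_unit[OF x]] by linarith
  qed (use b(1)[OF x] in simp_all)
  ultimately show "\<bar>?h x - ?h' x\<bar> \<le> \<theta> * \<bar>?h (T x) - ?h' (T x)\<bar> + (\<bar>X - X'\<bar> + \<bar>Y - Y'\<bar>) * (1 + ?B)"
    by (rule abs_le_of_eq_add)
qed

section \<open>First-order expansion at the base parameter\<close>

text \<open>The affine coordinate solves the equation of \<open>semiconj\<close> for X = 1 / p and Y
  = 1 / q, so it is the term of order zero.\<close>

definition lin :: "real \<Rightarrow> real" where "lin x = (x - a) / (b - a)"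

text \<open>\<open>vL\<close> and \<open>vR\<close> are minus the partial derivatives of
  \<open>semiconj X Y\<close> at the base parameter with respect to e = 1 - p * X and f = 1 - q * Y.
  Differentiating h = w * (h o T - 1) leaves \<open>lin\<close> as a source on the branch whose
  slope moves.\<close>

definition vL :: "real \<Rightarrow> real" where
  "vL = cocycle_sum (inv_slope (1 / p) (1 / q)) (\<lambda>x. if x < a then lin x else 0)"
definition vR :: "real \<Rightarrow> real" where
  "vR = cocycle_sum (inv_slope (1 / p) (1 / q)) (\<lambda>x. if a < x then lin x else 0)"

lemma lin_bound: "x \<in> {0..1} \<Longrightarrow> \<bar>lin x\<bar> \<le> 1 / (b - a)"
  using parameters by (auto simp: lin_def abs_divide intro!: divide_right_mono)

lemma lin_turning [simp]: "lin a = 0" "lin b = 1"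
  using parameters by (auto simp: lin_def)

lemma lin_step: "lin x = inv_slope (1 / p) (1 / q) x * (lin (T x) - 1)"
proof -
  have "lin (T x) = 1 + p * lin x" if "x \<le> a"
    using that parameters by (simp add: T_left lin_def field_simps)
  moreover have "lin (T x) = 1 - q * lin x" if "a \<le> x"
    using that parameters by (simp add: T_right lin_def field_simps)
  ultimately show ?thesis using slopes by (auto simp: inv_slope_def)
qed

lemma inv_r: "0 < 1 / r" "1 / r < 1" "\<bar>1 / p\<bar> \<le> 1 / r" "\<bar>1 / q\<bar> \<le> 1 / r"
  using slopes by (auto simp: frac_le)

lemma inv_slope_r: "\<bar>inv_slope (1 / p) (1 / q) x\<bar> \<le> 1 / r"
  using inv_slope_bound inv_r by blast

lemma
  assumes x: "x \<in> {0..1}"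
  shows vL_step: "vL x = (if x < a then lin x else 0) + inv_slope (1 / p) (1 / q) x * vL (T x)"
    and vL_bound: "\<bar>vL x\<bar> \<le> 1 / (b - a) / (1 - 1 / r)"
    and vR_step: "vR x = (if a < x then lin x else 0) + inv_slope (1 / p) (1 / q) x * vR (T x)"
    and vR_bound: "\<bar>vR x\<bar> \<le> 1 / (b - a) / (1 - 1 / r)"
proof -
  have f: "\<bar>if x < a then lin x else 0\<bar> \<le> 1 / (b - a)" "\<bar>if a < x then lin x else 0\<bar> \<le> 1 / (b - a)"
    if "x \<in> {0..1}" for x
    using lin_bound[OF that] parameters by auto
  show "vL x = (if x < a then lin x else 0) + inv_slope (1 / p) (1 / q) x * vL (T x)"
    unfolding vL_def by (rule cocycle_sum_step[OF inv_slope_r inv_r(2) f(1) x])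
  show "vR x = (if a < x then lin x else 0) + inv_slope (1 / p) (1 / q) x * vR (T x)"
    unfolding vR_def by (rule cocycle_sum_step[OF inv_slope_r inv_r(2) f(2) x])
  show "\<bar>vL x\<bar> \<le> 1 / (b - a) / (1 - 1 / r)"
    unfolding vL_def by (rule cocycle_sum_bound[OF inv_slope_r inv_r(2) f(1) x])
  show "\<bar>vR x\<bar> \<le> 1 / (b - a) / (1 - 1 / r)"
    unfolding vR_def by (rule cocycle_sum_bound[OF inv_slope_r inv_r(2) f(2) x])
qed

lemma semiconj_close_to_lin:
  assumes \<theta>: "\<bar>X\<bar> \<le> \<theta>" "\<bar>Y\<bar> \<le> \<theta>" "1 / r \<le> \<theta>" "\<theta> < 1" and x: "x \<in> {0..1}"
  shows "\<bar>semiconj X Y x - lin x\<bar> \<le> (\<bar>1 - p * X\<bar> + \<bar>1 - q * Y\<bar>) * (1 / (b - a)) / (1 - \<theta>)"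
proof (rule contraction_bound[where S="{0..1}" and g=T, OF T_unit _ _ _ \<theta>(4) x])
  show "\<bar>semiconj X Y x - lin x\<bar> \<le> 1 / (1 - \<theta>) + 1 / (b - a)" if "x \<in> {0..1}" for x
    using semiconj_bound[OF \<theta>(1,2,4) that] lin_bound[OF that] by linarith
  show "0 \<le> \<theta>" using \<theta>(1) by linarith
  fix x :: real assume x: "x \<in> {0..1}"
  have lt: "\<bar>X\<bar> < 1" "\<bar>Y\<bar> < 1" using \<theta> by (meson le_less_trans)+
  \<comment> \<open>\<open>inv_slope\<close> negates its second argument, so \<open>?e\<close> is 1
    - p * X on the left, 1 - q * Y on the right and 0 at \<open>a\<close>.\<close>
  let ?h = "semiconj X Y" and ?w = "inv_slope X Y" and ?e = "inv_slope (1 - p * X) (q * Y - 1) x"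
  have "?w x * (lin (T x) - 1) = (1 - ?e) * lin x"
    using lin_step[of x] slopes by (auto simp: inv_slope_def)
  then have "?h x - lin x = ?w x * (?h (T x) - lin (T x)) - ?e * lin x"
    using semiconj_step[OF lt x] by (simp add: algebra_simps)
  moreover have "\<bar>?w x * (?h (T x) - lin (T x))\<bar> \<le> \<theta> * \<bar>?h (T x) - lin (T x)\<bar>"
    unfolding abs_mult using inv_slope_bound[OF \<theta>(1,2)] by (intro mult_right_mono) auto
  moreover have "\<bar>?e * lin x\<bar> \<le> (\<bar>1 - p * X\<bar> + \<bar>1 - q * Y\<bar>) * (1 / (b - a))"
    unfolding abs_mult using lin_bound[OF x] by (intro mult_mono) (auto simp: inv_slope_def)
  ultimately show "\<bar>?h x - lin x\<bar> \<le> \<theta> * \<bar>?h (T x) - lin (T x)\<bar> + (\<bar>1 - p * X\<bar> + \<bar>1 - q * Y\<bar>) * (1 / (b - a))"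
    by (intro abs_le_of_eq_add[of _ "?w x * (?h (T x) - lin (T x))" "- (?e * lin x)"]) auto
qed

text \<open>With u = e * vL + f * vR, the remainder h - lin + u satisfies the contracting equation
  again. Its source is e or f times the unperturbed inverse slope times u o T, a product of two
  first-order quantities.\<close>

lemma semiconj_expansion:
  assumes \<theta>: "\<bar>X\<bar> \<le> \<theta>" "\<bar>Y\<bar> \<le> \<theta>" "1 / r \<le> \<theta>" "\<theta> < 1" and x: "x \<in> {0..1}"
  shows "\<bar>semiconj X Y x - lin x + (1 - p * X) * vL x + (1 - q * Y) * vR x\<bar>
    \<le> (\<bar>1 - p * X\<bar> + \<bar>1 - q * Y\<bar>)\<^sup>2 * (1 / (b - a) / (1 - 1 / r)) / (1 - \<theta>)"
proof -
  define e f where "e = 1 - p * X" and "f = 1 - q * Y"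
  let ?N = "\<bar>e\<bar> + \<bar>f\<bar>" and ?K = "1 / (b - a) / (1 - 1 / r)"
  let ?h = "semiconj X Y" and ?w = "inv_slope X Y" and ?v = "inv_slope (1 / p) (1 / q)"
  define u where "u x = e * vL x + f * vR x" for x
  have ub: "\<bar>u x\<bar> \<le> ?N * ?K" if "x \<in> {0..1}" for x
  proof -
    have "\<bar>u x\<bar> \<le> \<bar>e\<bar> * \<bar>vL x\<bar> + \<bar>f\<bar> * \<bar>vR x\<bar>"
      unfolding u_def by (simp add: abs_mult[symmetric] abs_triangle_ineq)
    also have "\<dots> \<le> \<bar>e\<bar> * ?K + \<bar>f\<bar> * ?K"
      using vL_bound[OF that] vR_bound[OF that] by (intro add_mono mult_left_mono) auto
    finally show ?thesis by (simp only: distrib_right)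
  qed
  have "\<bar>?h x - lin x + u x\<bar> \<le> (?N * (?N * ?K)) / (1 - \<theta>)"
  proof (rule contraction_bound[where S="{0..1}" and g=T, OF T_unit _ _ _ \<theta>(4) x])
    show "\<bar>?h x - lin x + u x\<bar> \<le> 1 / (1 - \<theta>) + 1 / (b - a) + ?N * ?K" if "x \<in> {0..1}" for x
      using semiconj_bound[OF \<theta>(1,2,4) that] lin_bound[OF that] ub[OF that] by linarith
    show "0 \<le> \<theta>" using \<theta>(1) by linarith
    fix x :: real assume x: "x \<in> {0..1}"
    have lt: "\<bar>X\<bar> < 1" "\<bar>Y\<bar> < 1" using \<theta> by (meson le_less_trans)+
    let ?e = "inv_slope e (- f) x"
    have w: "?w x = (1 - ?e) * ?v x"
    proof -
      have "(1 - e) / p = X" "(1 - f) / q = Y" using slopes by (simp_all add: e_def f_def)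
      then show ?thesis by (auto simp: inv_slope_def)
    qed
    have "u x = ?e * lin x + ?v x * u (T x)"
      unfolding u_def using vL_step[OF x] vR_step[OF x] by (auto simp: inv_slope_def algebra_simps)
    moreover have "?w x * (lin (T x) - 1) = (1 - ?e) * lin x"
      unfolding w using lin_step[of x] by simp
    then have "?h x - lin x = ?w x * (?h (T x) - lin (T x)) - ?e * lin x"
      using semiconj_step[OF lt x] by (simp add: algebra_simps)
    ultimately have "?h x - lin x + u x = ?w x * (?h (T x) - lin (T x) + u (T x)) + ?e * (?v x * u (T x))"
      unfolding w by (simp add: algebra_simps)
    moreover have "\<bar>?w x * (?h (T x) - lin (T x) + u (T x))\<bar> \<le> \<theta> * \<bar>?h (T x) - lin (T x) + u (T x)\<bar>"
      unfolding abs_mult using inv_slope_bound[OF \<theta>(1,2)] by (intro mult_right_mono) auto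
    moreover have "\<bar>?e * (?v x * u (T x))\<bar> \<le> ?N * (?N * ?K)"
      unfolding abs_mult
    proof (rule mult_mono)
      have "\<bar>?v x\<bar> * \<bar>u (T x)\<bar> \<le> 1 * (?N * ?K)"
        using order.trans[OF inv_slope_r[of x] less_imp_le[OF inv_r(2)]] ub[OF T_unit[OF x]]
        by (intro mult_mono) auto
      then show "\<bar>?v x\<bar> * \<bar>u (T x)\<bar> \<le> ?N * ?K" by simp
    qed (auto simp: inv_slope_def)
    ultimately show "\<bar>?h x - lin x + u x\<bar> \<le> \<theta> * \<bar>?h (T x) - lin (T x) + u (T x)\<bar> + ?N * (?N * ?K)"
      by (rule abs_le_of_eq_add)
  qed
  also have "(?N * (?N * ?K)) / (1 - \<theta>) = ?N\<^sup>2 * ?K / (1 - \<theta>)"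
    by (simp only: power2_eq_square mult.assoc)
  finally show ?thesis unfolding u_def e_def f_def by (simp only: add.assoc)
qed

text \<open>For a solution \<open>h\<close>, the functions \<open>t\<^sup>n h\<close> would be an unbounded sequence of pullbacks.\<close>
lemma no_semiconj_to_steeper:
  assumes "1 < t"
  shows "semiconj (1 / (t * p)) (1 / (t * q)) b \<noteq> 1"
proof
  let ?h = "semiconj (1 / (t * p)) (1 / (t * q))"
  assume h: "?h b = 1"
  have tpq: "1 < t * p" "1 < t * q" using assms slopes by (auto intro: less_1_mult)
  have X: "0 < 1 / (t * p)" "1 / (t * p) < 1" "0 < 1 / (t * q)" "1 / (t * q) < 1"
    using tpq by (simp_all add: divide_simps split: if_splits)
  have pb: "pullback (t * p) (t * q) ?h ?h" using semiconj_pullback[OF X h] by simp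
  have "pullback p q (\<lambda>x. t ^ n * ?h x) (\<lambda>x. t ^ Suc n * ?h x)" for n
  proof -
    have scale: "t ^ n * u - t ^ n * v = s * (t ^ Suc n * u' - t ^ Suc n * v')"
      if "u - v = (t * s) * (u' - v')" for u v u' v' s :: real
    proof -
      have "t ^ n * u - t ^ n * v = t ^ n * (u - v)" by (simp add: right_diff_distrib)
      also have "\<dots> = s * (t ^ Suc n * u' - t ^ Suc n * v')" unfolding that by (simp add: algebra_simps)
      finally show ?thesis .
    qed
    show ?thesis
      unfolding pullback_def
      using pb[unfolded pullback_def] by (intro conjI ballI; intro scale) auto
  qed
  moreover obtain \<theta> where \<theta>: "\<bar>1 / (t * p)\<bar> \<le> \<theta>" "\<bar>1 / (t * q)\<bar> \<le> \<theta>" "\<theta> < 1"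
    using X by (metis abs_of_pos max.cobounded1 max.cobounded2 max_less_iff_conj)
  ultimately obtain k B where "k > 0"
    and B: "\<And>i x y. x \<in> {0..1} \<Longrightarrow> y \<in> {0..1} \<Longrightarrow> \<bar>t ^ (i * k) * ?h y - t ^ (i * k) * ?h x\<bar> \<le> B"
    using pullback_bounded[of "\<lambda>n x. t ^ n * ?h x" "1 / (1 - \<theta>)"] semiconj_bound[OF \<theta>] by auto
  \<comment> \<open>Since h a = 0 and h b = 1, the increment from \<open>a\<close> to
    \<open>b\<close> is exactly the power of t.\<close>
  have "\<bar>t ^ (i * k)\<bar> \<le> B" for i using B[OF turning_unit(1,2), of i] h X by simp
  then have "(t ^ k) ^ i \<le> B" for i
    by (metis abs_le_D1 mult.commute power_mult)
  moreover have "1 < t ^ k" using assms \<open>k > 0\<close> by (simp add: one_less_power)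
  then obtain i where "B < (t ^ k) ^ i" using real_arch_pow by blast
  ultimately show False by (meson not_le)
qed

subsection \<open>Invariant measures\<close>

definition branch_sum :: "real \<Rightarrow> real \<Rightarrow> nat \<Rightarrow> real \<Rightarrow> real" where
  "branch_sum e f n x = (\<Sum>k<n. if (T ^^ k) x \<le> a then e else f)"

lemma branch_sum_0 [simp]: "branch_sum e f 0 x = 0"
  by (simp add: branch_sum_def)

lemma branch_sum_Suc: "branch_sum e f (Suc n) x = (if x \<le> a then e else f) + branch_sum e f n (T x)"
  unfolding branch_sum_def by (simp only: sum.lessThan_Suc_shift funpow_Suc_right comp_apply funpow_0)

lemma branch_sum_measurable [measurable]: "branch_sum e f n \<in> borel_measurable borel"
  unfolding branch_sum_def by measurable

lemma branch_sum_bound: "\<bar>branch_sum e f n x\<bar> \<le> real n * (\<bar>e\<bar> + \<bar>f\<bar>)"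
proof -
  have "\<bar>branch_sum e f n x\<bar> \<le> (\<Sum>k<n. \<bar>if (T ^^ k) x \<le> a then e else f\<bar>)"
    unfolding branch_sum_def by (rule sum_abs)
  also have "\<dots> \<le> (\<Sum>k<n. \<bar>e\<bar> + \<bar>f\<bar>)" by (intro sum_mono) auto
  finally show ?thesis by simp
qed

context
  fixes \<mu> :: "real measure"
  assumes acim: "is_acim a b \<mu>"
begin

lemma acim_sets [measurable_cong, simp]: "sets \<mu> = sets borel"
  using acim by (simp add: is_acim_def)

lemma acim_space [simp]: "space \<mu> = UNIV"
  using sets_eq_imp_space_eq[OF acim_sets] by simp

lemma acim_prob: "prob_space \<mu>"
  using acim by (intro prob_spaceI) (simp add: is_acim_def)

lemma acim_AE_unit: "AE x in \<mu>. x \<in> {0..1}"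
proof -
  interpret prob_space \<mu> by (rule acim_prob)
  have "prob {0..1} = 1" using acim by (simp add: is_acim_def measure_def)
  then show ?thesis using prob_eq_1[of "{0..1}"] by simp
qed

lemma acim_distr: "distr \<mu> borel T = \<mu>"
proof (rule measure_eqI)
  fix A assume "A \<in> sets (distr \<mu> borel T)"
  then have "A \<in> sets borel" by simp
  then show "emeasure (distr \<mu> borel T) A = emeasure \<mu> A"
    using acim by (simp add: emeasure_distr is_acim_def)
qed simp

lemma acim_integral_funpow:
  fixes g :: "real \<Rightarrow> real"
  assumes [measurable]: "g \<in> borel_measurable borel"
  shows "(\<integral>x. g ((T ^^ k) x) \<partial>\<mu>) = (\<integral>x. g x \<partial>\<mu>)"
proof (induction k)
  case (Suc k)
  have "(\<integral>x. g ((T ^^ Suc k) x) \<partial>\<mu>) = (\<integral>x. g ((T ^^ k) x) \<partial>distr \<mu> borel T)"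
    unfolding funpow_Suc_right by (subst integral_distr) auto
  then show ?case using Suc by (simp only: acim_distr)
qed simp

lemma acim_integrable_bounded:
  fixes g :: "real \<Rightarrow> real"
  assumes [measurable]: "g \<in> borel_measurable borel" and "\<And>x. \<bar>g x\<bar> \<le> K"
  shows "integrable \<mu> g"
proof -
  interpret prob_space \<mu> by (rule acim_prob)
  show ?thesis by (rule integrable_const_bound[of _ K]) (use assms in auto)
qed

lemma acim_integral_branch_sum:
  "(\<integral>x. branch_sum e f n x \<partial>\<mu>) = real n * (e * measure \<mu> {0..a} + f * (1 - measure \<mu> {0..a}))"
proof -
  interpret prob_space \<mu> by (rule acim_prob)
  let ?g = "\<lambda>x. if x \<le> a then e else f"
  have "(\<integral>x. ?g x \<partial>\<mu>) = (\<integral>x. f + (e - f) * indicator {..a} x \<partial>\<mu>)"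
    by (intro Bochner_Integration.integral_cong) (auto simp: indicator_def)
  also have "\<dots> = (\<integral>x. f \<partial>\<mu>) + (\<integral>x. (e - f) * indicator {..a} x \<partial>\<mu>)"
    by (intro Bochner_Integration.integral_add acim_integrable_bounded[where K="\<bar>f\<bar>"]
        acim_integrable_bounded[where K="\<bar>e - f\<bar>"]) (auto simp: indicator_def)
  also have "\<dots> = f + (e - f) * measure \<mu> {..a}" by (simp add: prob_space[simplified])
  also have "measure \<mu> {..a} = measure \<mu> {0..a}"
    by (rule measure_eq_AE) (use acim_AE_unit in auto)
  finally have "(\<integral>x. ?g x \<partial>\<mu>) = e * measure \<mu> {0..a} + f * (1 - measure \<mu> {0..a})"
    by (simp add: algebra_simps)
  moreover have "(\<integral>x. branch_sum e f n x \<partial>\<mu>) = (\<Sum>k<n. \<integral>x. ?g ((T ^^ k) x) \<partial>\<mu>)"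
    unfolding branch_sum_def
    by (intro Bochner_Integration.integral_sum acim_integrable_bounded[where K="\<bar>e\<bar> + \<bar>f\<bar>"]) auto
  moreover have "(\<integral>x. ?g ((T ^^ k) x) \<partial>\<mu>) = (\<integral>x. ?g x \<partial>\<mu>)" for k
    by (rule acim_integral_funpow) measurable
  ultimately show ?thesis by simp
qed

text \<open>The logarithm of the derivative is a Birkhoff sum of ln p and ln q. Its time averages
  are uniformly bounded and by invariance all have the same integral, so dominated convergence
  identifies the constant almost sure limit with that integral.\<close>

lemma lyapunov_exponent_eq:
  assumes "is_lyapunov_exponent a b \<mu> \<Lambda>"
  shows "\<Lambda> = measure \<mu> {0..a} * ln p + (1 - measure \<mu> {0..a}) * ln q"
proof -
  interpret prob_space \<mu> by (rule acim_prob)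
  let ?c = "measure \<mu> {0..a} * ln p + (1 - measure \<mu> {0..a}) * ln q"
  let ?S = "branch_sum (ln p) (ln q)"
  have "ln (iter_deriv_abs a b N x) = ?S N x" for N x
  proof -
    have d: "\<bar>skew_tent_deriv a b y\<bar> = (if y \<le> a then p else q)" for y
      using slopes by (auto simp: skew_tent_deriv_def p_def[symmetric] q_def[symmetric])
    have "ln (iter_deriv_abs a b N x) = (\<Sum>k<N. ln \<bar>skew_tent_deriv a b ((T ^^ k) x)\<bar>)"
      unfolding iter_deriv_abs_def by (rule ln_prod) (use slopes in \<open>auto simp: d\<close>)
    also have "\<dots> = ?S N x"
      unfolding branch_sum_def by (rule sum.cong) (simp_all add: d)
    finally show ?thesis .
  qed
  then have ae: "AE x in \<mu>. (\<lambda>N. ?S N x / real N) \<longlonglongrightarrow> \<Lambda>"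
    using assms by (simp add: is_lyapunov_exponent_def)
  have "(\<lambda>N. \<integral>x. ?S N x / real N \<partial>\<mu>) \<longlonglongrightarrow> (\<integral>x. \<Lambda> \<partial>\<mu>)"
  proof (rule integral_dominated_convergence[where w="\<lambda>_. \<bar>ln p\<bar> + \<bar>ln q\<bar>"])
    show "AE x in \<mu>. norm (?S N x / real N) \<le> \<bar>ln p\<bar> + \<bar>ln q\<bar>" for N
    proof (rule AE_I2)
      fix x
      show "norm (?S N x / real N) \<le> \<bar>ln p\<bar> + \<bar>ln q\<bar>"
        using branch_sum_bound[of "ln p" "ln q" N x]
        by (cases "N = 0") (simp_all add: divide_le_eq mult.commute)
    qed
  qed (use ae in auto)
  moreover have "\<forall>\<^sub>F N in sequentially. (\<integral>x. ?S N x / real N \<partial>\<mu>) = ?c"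
    using eventually_gt_at_top[of 0]
    by eventually_elim (simp add: acim_integral_branch_sum mult.commute)
  ultimately have "(\<lambda>N. ?c) \<longlonglongrightarrow> (\<integral>x. \<Lambda> \<partial>\<mu>)"
    by (rule Lim_transform_eventually)
  then have "(\<integral>x. \<Lambda> \<partial>\<mu>) = ?c" by (simp add: LIMSEQ_const_iff)
  then show ?thesis by (simp add: prob_space[simplified])
qed

end

section \<open>Birkhoff sums integrated over intervals against Lebesgue measure\<close>

definition lebesgue_branch_sum :: "real \<Rightarrow> real \<Rightarrow> nat \<Rightarrow> real \<Rightarrow> real \<Rightarrow> real" where
  "lebesgue_branch_sum e f n c d = (\<integral>x. indicator {c..d} x * branch_sum e f n x \<partial>lborel)"

lemma integrable_Icc_bounded:
  fixes g :: "real \<Rightarrow> real"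
  assumes [measurable]: "g \<in> borel_measurable borel" and K: "\<And>x. \<bar>g x\<bar> \<le> K"
  shows "integrable lborel (\<lambda>x. indicator {c..d} x * g x)"
proof (rule Bochner_Integration.integrable_bound[of _ "\<lambda>x. indicator {c..d} x * K"])
  show "AE x in lborel. norm (indicator {c..d} x * g x) \<le> norm (indicator {c..d} x * K)"
  proof (rule AE_I2)
    fix x
    show "norm (indicator {c..d} x * g x) \<le> norm (indicator {c..d} x * K)"
      using order_trans[OF K abs_ge_self] by (simp add: indicator_def)
  qed
qed auto

lemma branch_sum_integrable: "integrable lborel (\<lambda>x. indicator {c..d} x * branch_sum e f n x)"
  by (rule integrable_Icc_bounded[OF _ branch_sum_bound]) measurable

lemma branch_sum_T_integrable: "integrable lborel (\<lambda>x. indicator {c..d} x * branch_sum e f n (T x))"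
  by (rule integrable_Icc_bounded[OF _ branch_sum_bound]) measurable

lemma lebesgue_branch_sum_split:
  assumes "c \<le> m" "m \<le> d"
  shows "lebesgue_branch_sum e f n c d = lebesgue_branch_sum e f n c m + lebesgue_branch_sum e f n m d"
proof -
  have "lebesgue_branch_sum e f n c d = (\<integral>x. indicator {c..m} x * branch_sum e f n x + indicator {m..d} x * branch_sum e f n x \<partial>lborel)"
    unfolding lebesgue_branch_sum_def
  proof (rule integral_cong_AE)
    show "AE x in lborel. indicator {c..d} x * branch_sum e f n x
        = indicator {c..m} x * branch_sum e f n x + indicator {m..d} x * branch_sum e f n x"
      using AE_lborel_singleton[of m]
    proof eventually_elim
      case (elim x)
      have "indicator {c..d} x = (indicator {c..m} x + indicator {m..d} x :: real)"
        using elim assms by (simp add: indicator_def)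
      then show ?case by (simp only: distrib_right)
    qed
  qed (intro borel_measurable_integrable Bochner_Integration.integrable_add branch_sum_integrable)+
  then show ?thesis
    unfolding lebesgue_branch_sum_def by (simp add: branch_sum_integrable)
qed

text \<open>The hypothesis concerns the open interval because on a right-hand interval with c = a
  the end point takes the value e, not f.\<close>

lemma lebesgue_branch_sum_Suc:
  assumes "\<And>x. x \<in> {c<..<d} \<Longrightarrow> (if x \<le> a then e else f) = s" "c \<le> d"
  shows "lebesgue_branch_sum e f (Suc n) c d
    = s * (d - c) + (\<integral>x. indicator {c..d} x * branch_sum e f n (T x) \<partial>lborel)"
proof -
  have "lebesgue_branch_sum e f (Suc n) c d = (\<integral>x. s * indicator {c..d} x + indicator {c..d} x * branch_sum e f n (T x) \<partial>lborel)"
    unfolding lebesgue_branch_sum_def branch_sum_Suc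
  proof (rule integral_cong_AE)
    show "AE x in lborel. indicator {c..d} x * ((if x \<le> a then e else f) + branch_sum e f n (T x))
        = s * indicator {c..d} x + indicator {c..d} x * branch_sum e f n (T x)"
      using AE_lborel_singleton[of c] AE_lborel_singleton[of d]
    proof eventually_elim
      case (elim x)
      show ?case
      proof (cases "x \<in> {c<..<d}")
        case True
        then show ?thesis using assms(1)[OF True] by (simp add: distrib_left mult.commute)
      next
        case False
        then have "x \<notin> {c..d}" using elim by auto
        then show ?thesis by simp
      qed
    qed
    show "(\<lambda>x. indicator {c..d} x * ((if x \<le> a then e else f) + branch_sum e f n (T x))) \<in> borel_measurable lborel"
      by (rule borel_measurable_integrable[OF branch_sum_integrable[of c d e f "Suc n", unfolded branch_sum_Suc]])
    show "(\<lambda>x. s * indicator {c..d} x + indicator {c..d} x * branch_sum e f n (T x)) \<in> borel_measurable lborel"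
      by (intro borel_measurable_integrable Bochner_Integration.integrable_add branch_sum_T_integrable) simp
  qed
  also have "\<dots> = s * (d - c) + (\<integral>x. indicator {c..d} x * branch_sum e f n (T x) \<partial>lborel)"
    using branch_sum_T_integrable \<open>c \<le> d\<close> by simp
  finally show ?thesis .
qed

text \<open>The substitution y = T x costs the factor p and shifts the sum by one time step, whose
  dropped first term is the constant e.\<close>

lemma lebesgue_branch_sum_Suc_left:
  assumes "c \<le> d" "d \<le> a"
  shows "lebesgue_branch_sum e f n (T c) (T d) = p * (lebesgue_branch_sum e f (Suc n) c d - e * (d - c))"
proof -
  have "lebesgue_branch_sum e f n (T c) (T d)
      = \<bar>p\<bar> *\<^sub>R (\<integral>x. indicator {T c..T d} (b - p * a + p * x) * branch_sum e f n (b - p * a + p * x) \<partial>lborel)"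
    unfolding lebesgue_branch_sum_def using slopes by (intro lborel_integral_real_affine) auto
  also have "(\<lambda>x. indicator {T c..T d} (b - p * a + p * x) * branch_sum e f n (b - p * a + p * x))
      = (\<lambda>x. indicator {c..d} x * branch_sum e f n (T x))"
  proof
    fix x
    have "b - p * a + p * x \<in> {T c..T d} \<longleftrightarrow> x \<in> {c..d}"
      using assms slopes by (simp add: T_left algebra_simps)
    moreover have "b - p * a + p * x = T x" if "x \<in> {c..d}"
      using assms that by (simp add: T_left algebra_simps)
    ultimately show "indicator {T c..T d} (b - p * a + p * x) * branch_sum e f n (b - p * a + p * x)
        = indicator {c..d} x * branch_sum e f n (T x)"
      by (cases "x \<in> {c..d}") auto
  qed
  finally show ?thesis
    using slopes lebesgue_branch_sum_Suc[of c d e f e n] assms by simp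
qed

lemma lebesgue_branch_sum_Suc_right:
  assumes "c \<le> d" "a \<le> c"
  shows "lebesgue_branch_sum e f n (T d) (T c) = q * (lebesgue_branch_sum e f (Suc n) c d - f * (d - c))"
proof -
  have "lebesgue_branch_sum e f n (T d) (T c)
      = \<bar>- q\<bar> *\<^sub>R (\<integral>x. indicator {T d..T c} (b + q * a + - q * x) * branch_sum e f n (b + q * a + - q * x) \<partial>lborel)"
    unfolding lebesgue_branch_sum_def using slopes by (intro lborel_integral_real_affine) auto
  also have "(\<lambda>x. indicator {T d..T c} (b + q * a + - q * x) * branch_sum e f n (b + q * a + - q * x))
      = (\<lambda>x. indicator {c..d} x * branch_sum e f n (T x))"
  proof
    fix x
    have "b + q * a + - q * x \<in> {T d..T c} \<longleftrightarrow> x \<in> {c..d}"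
      using assms slopes by (auto simp: T_right algebra_simps)
    moreover have "b + q * a + - q * x = T x" if "x \<in> {c..d}"
      using assms that by (simp add: T_right algebra_simps)
    ultimately show "indicator {T d..T c} (b + q * a + - q * x) * branch_sum e f n (b + q * a + - q * x)
        = indicator {c..d} x * branch_sum e f n (T x)"
      by (cases "x \<in> {c..d}") auto
  qed
  finally show ?thesis
    using slopes lebesgue_branch_sum_Suc[of c d e f f n] assms by simp
qed

text \<open>v is the derivative of the semiconjugacy in the direction (e, f). The series gives the
  equations away from \<open>a\<close>, and v a = 0. The hypothesis says v b = 0, which makes the
  equations of both branches hold at \<open>a\<close> as well.\<close>

lemma twisted_solution:
  fixes e f :: real
  defines "v \<equiv> \<lambda>x. - (e * vL x + f * vR x)"
  assumes "e * vL b + f * vR b = 0"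
  shows twisted_solution_left: "0 \<le> x \<Longrightarrow> x \<le> a \<Longrightarrow> v (T x) = p * (v x + e * lin x)"
    and twisted_solution_right: "a \<le> x \<Longrightarrow> x \<le> 1 \<Longrightarrow> v (T x) = - q * (v x + f * lin x)"
proof -
  have "v b = 0" using assms by (simp add: v_def)
  have "v a = 0" using vL_step[of a] vR_step[of a] parameters by (simp add: v_def inv_slope_def)
  show "v (T x) = p * (v x + e * lin x)" if "0 \<le> x" "x \<le> a"
  proof (cases "x = a")
    case True
    then show ?thesis using \<open>v a = 0\<close> \<open>v b = 0\<close> by simp
  next
    case False
    then have eqs: "vL (T x) = p * (vL x - lin x)" "vR (T x) = p * vR x"
      using vL_step[of x] vR_step[of x] that parameters slopes by (simp_all add: inv_slope_def)
    show ?thesis unfolding v_def eqs by (simp add: algebra_simps)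
  qed
  show "v (T x) = - q * (v x + f * lin x)" if "a \<le> x" "x \<le> 1"
  proof (cases "x = a")
    case True
    then show ?thesis using \<open>v a = 0\<close> \<open>v b = 0\<close> by simp
  next
    case False
    then have eqs: "vL (T x) = - q * vL x" "vR (T x) = q * (lin x - vR x)"
      using vL_step[of x] vR_step[of x] that parameters slopes by (simp_all add: inv_slope_def)
    show ?thesis unfolding v_def eqs by (simp add: algebra_simps)
  qed
qed

text \<open>The functions \<open>x \<mapsto> \<integral>\<^sub>0\<^sup>x (e 1\<^sub>L + f 1\<^sub>R + \<dots>) + (b - a) v\<close> are successive pullbacks, because
  \<open>v\<close> absorbs the boundary terms of the change of variables; so the integrals stay bounded.\<close>
lemma lebesgue_branch_sum_bounded:
  assumes ef: "e * vL b + f * vR b = 0"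
  obtains k B where "k > 0" "\<And>i y. y \<in> {0..1} \<Longrightarrow> \<bar>lebesgue_branch_sum e f (i * k) 0 y\<bar> \<le> B"
proof -
  define v where "v x = - (e * vL x + f * vR x)" for x
  define V where "V n x = lebesgue_branch_sum e f n 0 x + (b - a) * v x" for n x
  note vl = twisted_solution_left[OF ef, folded v_def] and vr = twisted_solution_right[OF ef, folded v_def]
  have lin: "(b - a) * lin x = x - a" for x using parameters by (simp add: lin_def)
  have vlin: "(b - a) * (s * (v x + t * lin x)) = s * ((b - a) * v x + t * (x - a))" for s t x
    unfolding lin[of x, symmetric] by (simp only: algebra_simps)
  have Vdiff: "V n y - V n x = lebesgue_branch_sum e f n x y + ((b - a) * v y - (b - a) * v x)"
    if "0 \<le> x" "x \<le> y" for n x y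
    using lebesgue_branch_sum_split[OF that] by (simp add: V_def)
  have left: "V n (T y) - V n (T x) = p * (V (Suc n) y - V (Suc n) x)"
    if "0 \<le> x" "x \<le> y" "y \<le> a" for n x y
  proof -
    have "0 \<le> T x" "T x \<le> T y"
      using T_unit[of x] that parameters slopes by (auto simp: T_left)
    \<comment> \<open>The term -e * (y - x) left by the substitution cancels against the source e *
      lin of v, scaled by b - a.\<close>
    then have "V n (T y) - V n (T x) = p * (lebesgue_branch_sum e f (Suc n) x y - e * (y - x))
        + (p * ((b - a) * v y + e * (y - a)) - p * ((b - a) * v x + e * (x - a)))"
      using that vl[of x] vl[of y] by (simp add: Vdiff lebesgue_branch_sum_Suc_left vlin)
    then show ?thesis using that by (simp add: Vdiff algebra_simps)
  qed
  have right: "V n (T y) - V n (T x) = - q * (V (Suc n) y - V (Suc n) x)"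
    if "a \<le> x" "x \<le> y" "y \<le> 1" for n x y
  proof -
    have "0 \<le> T y" "T y \<le> T x" "0 \<le> x"
      using T_unit[of y] that parameters slopes by (auto simp: T_right)
    then have "V n (T x) - V n (T y) = q * (lebesgue_branch_sum e f (Suc n) x y - f * (y - x))
        + (- q * ((b - a) * v x + f * (x - a)) - - q * ((b - a) * v y + f * (y - a)))"
      using that vr[of x] vr[of y] by (simp only: Vdiff lebesgue_branch_sum_Suc_right vlin)
    then show ?thesis using that \<open>0 \<le> x\<close> by (simp add: Vdiff algebra_simps)
  qed
  have "pullback p q (V n) (V (Suc n))" for n
    unfolding pullback_def
  proof (intro conjI ballI)
    fix x y assume xy: "x \<in> {0..a}" "y \<in> {0..a}"
    show "V n (T y) - V n (T x) = p * (V (Suc n) y - V (Suc n) x)"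
    proof (cases "x \<le> y")
      case True then show ?thesis using left xy by simp
    next
      case False
      then have "V n (T x) - V n (T y) = p * (V (Suc n) x - V (Suc n) y)" using left xy by simp
      then show ?thesis by (simp add: algebra_simps)
    qed
  next
    fix x y assume xy: "x \<in> {a..1}" "y \<in> {a..1}"
    show "V n (T y) - V n (T x) = - q * (V (Suc n) y - V (Suc n) x)"
    proof (cases "x \<le> y")
      case True then show ?thesis using right xy by simp
    next
      case False
      then have "V n (T x) - V n (T y) = - q * (V (Suc n) x - V (Suc n) y)" using right xy by simp
      then show ?thesis by (simp add: algebra_simps)
    qed
  qed
  define K where "K = \<bar>e\<bar> * (1 / (b - a) / (1 - 1 / r)) + \<bar>f\<bar> * (1 / (b - a) / (1 - 1 / r))"
  have vb: "\<bar>(b - a) * v x\<bar> \<le> (b - a) * K" if "x \<in> {0..1}" for x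
  proof -
    have "\<bar>v x\<bar> \<le> \<bar>e * vL x\<bar> + \<bar>f * vR x\<bar>" unfolding v_def by linarith
    also have "\<dots> \<le> K"
      unfolding K_def abs_mult using vL_bound[OF that] vR_bound[OF that] by (intro add_mono mult_left_mono) auto
    finally show ?thesis using parameters by (simp add: abs_mult)
  qed
  have V0: "\<bar>V 0 x\<bar> \<le> (b - a) * K" if "x \<in> {0..1}" for x
    using vb[OF that] by (simp add: V_def lebesgue_branch_sum_def)
  obtain k B where "k > 0" and
    B: "\<And>i x y. x \<in> {0..1} \<Longrightarrow> y \<in> {0..1} \<Longrightarrow> \<bar>V (i * k) y - V (i * k) x\<bar> \<le> B"
    using pullback_bounded[of V, OF \<open>\<And>n. pullback p q (V n) (V (Suc n))\<close> V0] by blast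
  show thesis
  proof (rule that[OF \<open>k > 0\<close>])
    fix i and y :: real assume y: "y \<in> {0..1}"
    show "\<bar>lebesgue_branch_sum e f (i * k) 0 y\<bar> \<le> B + (b - a) * K + (b - a) * K"
    proof -
      have "V (i * k) y - V (i * k) 0 = lebesgue_branch_sum e f (i * k) 0 y + ((b - a) * v y - (b - a) * v 0)"
        using y by (intro Vdiff) auto
      moreover have "\<bar>V (i * k) y - V (i * k) 0\<bar> \<le> B" using B y by simp
      moreover have "\<bar>(b - a) * v 0\<bar> \<le> (b - a) * K" using vb by simp
      ultimately show ?thesis using vb[OF y] by linarith
    qed
  qed
qed

section \<open>Mass balance of absolutely continuous invariant measures\<close>

text \<open>Time averages over i * k steps are bounded functions whose integrals over intervals are
  at most B / (i * k). Hence they tend to 0 against every integrable function, in particular against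
  the density of \<mu>. By invariance their \<mu>-integrals are the same for all i > 0, so this
  common value is 0.\<close>

lemma acim_balance:
  assumes acim: "is_acim a b \<mu>" and ef: "e * vL b + f * vR b = 0"
  shows "e * measure \<mu> {0..a} + f * (1 - measure \<mu> {0..a}) = 0"
proof -
  note [measurable_cong] = acim_sets[OF acim]
  interpret prob_space \<mu> by (rule acim_prob[OF acim])
  obtain k B where "k > 0" and
    B: "\<And>i y. y \<in> {0..1} \<Longrightarrow> \<bar>lebesgue_branch_sum e f (i * k) 0 y\<bar> \<le> B"
    using lebesgue_branch_sum_bounded[OF ef] by blast
  \<comment> \<open>The cut-off confines F to a bounded interval and is invisible to \<mu>. For i =
    0 division by 0 makes F vanish.\<close>
  define F where "F i x = indicator {0..1} x * (branch_sum e f (i * k) x / real (i * k))" for i x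
  have [measurable]: "F i \<in> borel_measurable borel" for i unfolding F_def by measurable
  have Fb: "\<bar>F i x\<bar> \<le> \<bar>e\<bar> + \<bar>f\<bar>" for i x
  proof (cases "i = 0")
    case False
    then have "\<bar>branch_sum e f (i * k) x\<bar> / real (i * k) \<le> \<bar>e\<bar> + \<bar>f\<bar>"
      using branch_sum_bound[of e f "i * k" x] \<open>k > 0\<close> by (simp add: divide_le_eq mult.commute)
    then show ?thesis by (auto simp: F_def indicator_def)
  qed (simp add: F_def)
  have null: "(\<lambda>i. \<integral>x. indicator {..y} x * F i x \<partial>lborel) \<longlonglongrightarrow> 0" for y
  proof (cases "0 \<le> y")
    case True
    have eq: "(\<integral>x. indicator {..y} x * F i x \<partial>lborel) = lebesgue_branch_sum e f (i * k) 0 (min y 1) / real (i * k)" for i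
    proof -
      have "indicator {..y} x * F i x = indicator {0..min y 1} x * branch_sum e f (i * k) x / real (i * k)" for x
      proof -
        have "{..y} \<inter> {0..1} = {0..min y 1}" by auto
        then have "indicator {..y} x * indicator {0..1} x = (indicator {0..min y 1} x :: real)"
          by (simp only: indicator_inter_arith[symmetric])
        then show ?thesis by (simp only: F_def mult.assoc[symmetric] times_divide_eq_right)
      qed
      then show ?thesis unfolding lebesgue_branch_sum_def by (simp only: integral_divide_zero)
    qed
    show ?thesis
      unfolding eq
    proof (rule Lim_null_comparison)
      show "\<forall>\<^sub>F i in sequentially. norm (lebesgue_branch_sum e f (i * k) 0 (min y 1) / real (i * k)) \<le> B / real (i * k)"
    proof (rule always_eventually, rule allI)
        fix i
        have "\<bar>lebesgue_branch_sum e f (i * k) 0 (min y 1)\<bar> \<le> B" using B True by simp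
        from divide_right_mono[OF this, of "real (i * k)"]
        show "norm (lebesgue_branch_sum e f (i * k) 0 (min y 1) / real (i * k)) \<le> B / real (i * k)"
          by (simp only: real_norm_def abs_divide abs_of_nat of_nat_0_le_iff)
      qed
      have "(\<lambda>i. (B / real k) / real i) \<longlonglongrightarrow> 0" by (rule lim_const_over_n)
      then show "(\<lambda>i. B / real (i * k)) \<longlonglongrightarrow> 0" by (simp add: mult.commute)
    qed
  next
    case False
    then have "indicator {..y} x * F i x = 0" for i x by (auto simp: F_def indicator_def)
    then show ?thesis by (simp only: integral_zero tendsto_const)
  qed
  have "absolutely_continuous lborel \<mu>"
    using acim unfolding is_acim_def by blast
  note ac = this trans[OF acim_sets[OF acim] sets_lborel[symmetric]]
  obtain D where Dm: "D \<in> borel_measurable lborel"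
    and RN: "AE x in lborel. RN_deriv lborel \<mu> x = ennreal (D x)" and "AE x in \<mu>. 0 < D x" and D0: "\<And>x. 0 \<le> D x"
    by (rule sigma_finite_measure.real_RN_deriv[OF sigma_finite_lborel finite_measure_axioms ac]) blast
  have [measurable]: "D \<in> borel_measurable borel" using Dm by simp
  have "density lborel (RN_deriv lborel \<mu>) = \<mu>"
    by (rule sigma_finite_measure.density_RN_deriv[OF sigma_finite_lborel ac])
  moreover have "density lborel (RN_deriv lborel \<mu>) = density lborel (\<lambda>x. ennreal (D x))"
    by (rule density_cong[OF borel_measurable_RN_deriv _ RN]) simp
  ultimately have dens: "density lborel (\<lambda>x. ennreal (D x)) = \<mu>" by simp
  have "integrable lborel D"
  proof -
    have "integrable \<mu> (\<lambda>x. 1 :: real)" by simp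
    then have "integrable (density lborel (\<lambda>x. ennreal (D x))) (\<lambda>x. 1 :: real)" unfolding dens .
    then show ?thesis by (subst (asm) integrable_real_density) (use D0 in auto)
  qed
  then have "(\<lambda>i. \<integral>x. D x * F i x \<partial>lborel) \<longlonglongrightarrow> 0"
    by (rule integral_tendsto_zero_of_intervals[where l=0 and u=1 and F=F, rotated -1, OF _ _ Fb _ null])
      (simp_all add: F_def)
  moreover have "(\<integral>x. D x * F i x \<partial>lborel) = (\<integral>x. F i x \<partial>\<mu>)" for i
    by (subst dens[symmetric], subst integral_real_density) (use D0 in auto)
  ultimately have lim: "(\<lambda>i. \<integral>x. F i x \<partial>\<mu>) \<longlonglongrightarrow> 0" by simp
  have Fint: "(\<integral>x. F i x \<partial>\<mu>) = e * measure \<mu> {0..a} + f * (1 - measure \<mu> {0..a})" if "0 < i" for i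
  proof -
    have "(\<integral>x. F i x \<partial>\<mu>) = (\<integral>x. branch_sum e f (i * k) x / real (i * k) \<partial>\<mu>)"
    proof (rule integral_cong_AE)
      show "AE x in \<mu>. F i x = branch_sum e f (i * k) x / real (i * k)"
        using acim_AE_unit[OF acim] by eventually_elim (simp add: F_def)
      have mb: "borel_measurable \<mu> = (borel_measurable borel :: (real \<Rightarrow> real) set)"
        by (rule measurable_cong_sets[OF acim_sets[OF acim] refl])
      show "F i \<in> borel_measurable \<mu>" unfolding mb by measurable
      show "(\<lambda>x. branch_sum e f (i * k) x / real (i * k)) \<in> borel_measurable \<mu>"
        unfolding mb by measurable
    qed
    then show ?thesis using acim_integral_branch_sum[OF acim, of e f "i * k"] that \<open>k > 0\<close> by simp
  qed
  have "(\<lambda>i::nat. e * measure \<mu> {0..a} + f * (1 - measure \<mu> {0..a})) \<longlonglongrightarrow> 0"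
    by (rule Lim_transform_eventually[OF lim eventually_mono[OF eventually_gt_at_top[of 0] Fint]])
  then show ?thesis by (simp add: LIMSEQ_const_iff)
qed

lemma acim_left_mass:
  assumes "is_acim a b \<mu>"
  shows "vL b + vR b \<noteq> 0" "measure \<mu> {0..a} * (vL b + vR b) = vL b"
proof -
  show "vL b + vR b \<noteq> 0"
    using acim_balance[OF assms, of 1 1] by auto
  show "measure \<mu> {0..a} * (vL b + vR b) = vL b"
    using acim_balance[OF assms, of "vR b" "- vL b"] by (simp add: algebra_simps)
qed

subsection \<open>Isentropes\<close>

text \<open>\<open>d n\<close> compares h along the orbit of \<open>a\<close> with the affine
  coordinate of the second map along the orbit of its own turning point. While the symbols agree,
  both satisfy the same recursion, so \<open>d n\<close> can be contracted by \<theta> any number of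
  times. At a C both are 0, so the end of a finite sequence does no harm.\<close>

lemma kneading_eq_imp_semiconj:
  assumes U': "(a', b') \<in> U_region" and eq: "kneading a b = kneading a' b'"
  shows "semiconj (a' / b') ((1 - a') / b') b = 1"
proof -
  interpret K: skew_tent_map a' b' by unfold_locales (rule U')
  define X Y where "X = a' / b'" and "Y = (1 - a') / b'"
  have XY: "0 < X" "X < 1" "0 < Y" "Y < 1" "1 / K.p = X" "1 / K.q = Y"
    using K.parameters by (simp_all add: X_def Y_def K.p_def K.q_def)
  define \<theta> where "\<theta> = max X Y"
  have \<theta>: "\<bar>X\<bar> \<le> \<theta>" "\<bar>Y\<bar> \<le> \<theta>" "\<theta> < 1" "0 \<le> \<theta>" using XY by (auto simp: \<theta>_def)
  let ?h = "semiconj X Y"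
  define d where "d n = ?h ((T ^^ n) a) - K.lin ((K.T ^^ n) a')" for n
  define M where "M = 1 / (1 - \<theta>) + 1 / (b' - a')"
  have dM: "\<bar>d n\<bar> \<le> M" for n
    using semiconj_bound[OF \<theta>(1-3) funpow_T_unit[OF turning_unit(1), of n]]
      K.lin_bound[OF K.funpow_T_unit[OF K.turning_unit(1), of n]]
    unfolding d_def M_def by linarith
  have step: "\<bar>d n\<bar> \<le> \<theta> ^ m * M"
    if "1 \<le> n" "\<And>j. 1 \<le> j \<Longrightarrow> j < n \<Longrightarrow> ext_kneading a b j \<noteq> C" for n m
    using that
  proof (induction m arbitrary: n)
    case 0
    then show ?case using dM by simp
  next
    case (Suc m)
    let ?x = "(T ^^ n) a" and ?y = "(K.T ^^ n) a'"
    have same: "ext_kneading a' b' n = ext_kneading a b n"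
      by (rule kneading_eq_prefix[OF eq Suc.prems])
    then have side: "?x < a \<longleftrightarrow> ?y < a'" "?x = a \<longleftrightarrow> ?y = a'"
      by (auto simp: ext_kneading_def Let_def split: if_splits)
    show ?case
    proof (cases "ext_kneading a b n = C")
      case True
      then have "?x = a" by (simp add: ext_kneading_def Let_def split: if_splits)
      then have "d n = 0" using side XY unfolding d_def by simp
      then show ?thesis using \<theta>(4) dM[of 0] by simp
    next
      case False
      have "\<bar>d (Suc n)\<bar> \<le> \<theta> ^ m * M"
        using Suc.prems False by (intro Suc.IH) (auto simp: less_Suc_eq)
      moreover have "d n = inv_slope X Y ?x * d (Suc n)"
      proof -
        have "?h ?x = inv_slope X Y ?x * (?h (T ?x) - 1)"
          using XY funpow_T_unit[OF turning_unit(1)] by (intro semiconj_step) auto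
        moreover have "K.lin ?y = K.inv_slope X Y ?y * (K.lin (K.T ?y) - 1)"
          using K.lin_step[of ?y] XY by simp
        moreover have "K.inv_slope X Y ?y = inv_slope X Y ?x"
          using side unfolding inv_slope_def K.inv_slope_def by auto
        ultimately show ?thesis unfolding d_def by (simp add: algebra_simps)
      qed
      moreover have "\<bar>inv_slope X Y ?x\<bar> * \<bar>d (Suc n)\<bar> \<le> \<theta> * (\<theta> ^ m * M)"
        using inv_slope_bound[OF \<theta>(1,2)] \<theta>(4) calculation(1) by (intro mult_mono) auto
      ultimately show ?thesis by (simp add: abs_mult)
    qed
  qed
  \<comment> \<open>Time 1 is the earliest informative one: at time 0 both orbits sit at the turning
    point. \<open>d 1\<close> is h b - 1.\<close>
  have "\<bar>d 1\<bar> \<le> \<theta> ^ m * M" for m by (rule step) auto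
  then have "\<exists>N. \<forall>m\<ge>N. \<bar>d 1\<bar> \<le> \<theta> ^ m * M" by blast
  moreover have "(\<lambda>m. \<theta> ^ m * M) \<longlonglongrightarrow> 0"
    using \<theta> by (intro tendsto_mult_left_zero LIMSEQ_realpow_zero) auto
  ultimately have "\<bar>d 1\<bar> \<le> 0" by (intro LIMSEQ_le_const)
  then show ?thesis using K.lin_turning(2) by (simp add: d_def X_def Y_def)
qed

text \<open>With \<open>a\<close> fixed, raising b to b' multiplies both slopes by b' / b > 1, which
  \<open>no_semiconj_to_steeper\<close> forbids.\<close>

lemma kneading_inj_above:
  assumes "(a, b') \<in> U_region" "kneading a b = kneading a b'"
  shows "b' \<le> b"
proof (rule ccontr)
  assume "\<not> b' \<le> b"
  then have "1 < b' / b" using parameters by simp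
  moreover have "1 / (b' / b * p) = a / b'" "1 / (b' / b * q) = (1 - a) / b'"
    using parameters by (simp_all add: p_def q_def)
  ultimately show False
    using no_semiconj_to_steeper[of "b' / b"] kneading_eq_imp_semiconj[OF assms] by simp
qed

section \<open>From the condition at \<open>b\<close> back to the kneading sequence\<close>

text \<open>Closeness to \<open>lin\<close> orders distant points. Close points are cut into good
  pieces and moved by T^k, under which h is stretched by more than 4 with the same orientation as
  T^k. So any bound for the violations of monotonicity can be halved, and so can any bound for the
  length of flat intervals.\<close>

lemma semiconj_strict_mono:
  obtains \<eta> where "0 < \<eta>"
    "\<And>X Y x y. \<bar>X - 1 / p\<bar> < \<eta> \<Longrightarrow> \<bar>Y - 1 / q\<bar> < \<eta> \<Longrightarrow> semiconj X Y b = 1 \<Longrightarrow>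
       0 \<le> x \<Longrightarrow> x < y \<Longrightarrow> y \<le> 1 \<Longrightarrow> semiconj X Y x < semiconj X Y y"
proof -
  \<comment> \<open>A value strictly between 1 and r leaves room for perturbed slopes: those nearby
    still expand by at least \<rho>, and one k serves them all.\<close>
  define \<rho> where "\<rho> = (1 + r) / 2"
  have \<rho>: "1 < \<rho>" "\<rho> < r" using slopes by (simp_all add: \<rho>_def)
  obtain k where k: "4 < \<rho> ^ k" using real_arch_pow[OF \<rho>(1)] by blast
  obtain \<delta> where \<delta>: "\<delta> > 0" and cut: "\<And>x y. 0 \<le> x \<Longrightarrow> x \<le> y \<Longrightarrow> y \<le> 1 \<Longrightarrow> y - x < \<delta> \<Longrightarrow>
      \<exists>m. x \<le> m \<and> m \<le> y \<and> good k x m \<and> good k m y"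
    using short_interval_cut[of k] by blast
  define \<theta> where "\<theta> = 1 / \<rho>"
  have \<theta>: "\<theta> < 1" "1 / r < \<theta>" "0 < \<theta>" using \<rho> by (simp_all add: \<theta>_def frac_less2)
  \<comment> \<open>These bounds keep X and Y positive and at most \<theta>, and bring h within
    \<delta> / (4 * (b - a)) of \<open>lin\<close>. Over a distance \<delta> / 2, \<open>lin\<close>
    grows by twice that amount.\<close>
  define \<eta> where "\<eta> = min (min (1 / p) (1 / q)) (min (\<theta> - 1 / r) (\<delta> * (1 - \<theta>) / (4 * (p + q))))"
  have "0 < \<eta>" using \<theta> \<delta> slopes by (simp add: \<eta>_def)
  moreover have "semiconj X Y x < semiconj X Y y"
    if X: "\<bar>X - 1 / p\<bar> < \<eta>" and Y: "\<bar>Y - 1 / q\<bar> < \<eta>" and hb: "semiconj X Y b = 1"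
      and xy: "0 \<le> x" "x < y" "y \<le> 1" for X Y x y
  proof -
    let ?h = "semiconj X Y"
    have \<eta>le: "\<eta> \<le> 1 / p" "\<eta> \<le> 1 / q" "\<eta> \<le> \<theta> - 1 / r" "\<eta> \<le> \<delta> * (1 - \<theta>) / (4 * (p + q))"
      by (simp_all add: \<eta>_def)
    have X0: "0 < X" and Y0: "0 < Y" using X Y \<eta>le by linarith+
    have "1 / p \<le> 1 / r" "1 / q \<le> 1 / r" using slopes by (simp_all add: frac_le)
    then have Xt: "X \<le> \<theta>" and Yt: "Y \<le> \<theta>" using X Y \<eta>le by linarith+
    have P: "\<rho> \<le> 1 / X" and Q: "\<rho> \<le> 1 / Y"
      using Xt Yt X0 Y0 \<rho> by (simp_all add: \<theta>_def field_simps)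
    have abs: "\<bar>X\<bar> \<le> \<theta>" "\<bar>Y\<bar> \<le> \<theta>" using X0 Y0 Xt Yt by simp_all
    have pb: "pullback (1 / X) (1 / Y) ?h ?h"
      using X0 Y0 Xt Yt \<theta> hb by (intro semiconj_pullback) auto
    have piece: "?h ((T ^^ k) y) - ?h ((T ^^ k) x) = pair_slope (1 / X) (1 / Y) k x y * (?h y - ?h x)"
      if "good k x y" "x \<in> {0..1}" "y \<in> {0..1}" for x y
      using pullback_good[of "1 / X" "1 / Y" "\<lambda>_. ?h", OF pb that] by simp
    have S': "4 < \<bar>pair_slope (1 / X) (1 / Y) k x y\<bar>" for x y
      using pair_slope_bound[OF P Q, of k x y] \<rho> k by linarith
    have S: "4 < \<bar>pair_slope p q k x y\<bar>" for x y
      using pair_slope_bound[of \<rho> p q k x y] \<rho> slopes k by linarith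
    have sgn: "0 < pair_slope p q k x y * pair_slope (1 / X) (1 / Y) k x y" for x y
      using slopes X0 Y0 by (intro pair_slope_sign) auto
    have near: "\<bar>?h x - lin x\<bar> < \<delta> / (4 * (b - a))" if "x \<in> {0..1}" for x
    proof -
      have "\<bar>1 - p * X\<bar> = p * \<bar>X - 1 / p\<bar>" "\<bar>1 - q * Y\<bar> = q * \<bar>Y - 1 / q\<bar>"
      proof -
        have "1 - p * X = - (p * (X - 1 / p))" "1 - q * Y = - (q * (Y - 1 / q))"
          using slopes by (simp_all add: right_diff_distrib)
        then show "\<bar>1 - p * X\<bar> = p * \<bar>X - 1 / p\<bar>" "\<bar>1 - q * Y\<bar> = q * \<bar>Y - 1 / q\<bar>"
          using slopes by (simp_all add: abs_mult)
      qed
      moreover have "p * \<bar>X - 1 / p\<bar> < p * \<eta>" "q * \<bar>Y - 1 / q\<bar> < q * \<eta>"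
        using X Y slopes by simp_all
      ultimately have "\<bar>1 - p * X\<bar> + \<bar>1 - q * Y\<bar> < (p + q) * \<eta>"
        by (simp add: distrib_right)
      also have "\<dots> \<le> (p + q) * (\<delta> * (1 - \<theta>) / (4 * (p + q)))"
        using \<eta>le slopes by (intro mult_left_mono) auto
      also have "\<dots> = \<delta> * (1 - \<theta>) / 4" using slopes by (simp add: field_simps)
      finally have "(\<bar>1 - p * X\<bar> + \<bar>1 - q * Y\<bar>) * (1 / (b - a)) / (1 - \<theta>)
          < \<delta> * (1 - \<theta>) / 4 * (1 / (b - a)) / (1 - \<theta>)"
        using \<theta> parameters by (intro divide_strict_right_mono mult_strict_right_mono) auto
      also have "\<dots> = \<delta> / (4 * (b - a))" using \<theta> by simp
      finally show ?thesis
        using semiconj_close_to_lin[OF abs less_imp_le[OF \<theta>(2)] \<theta>(1) that] by linarith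
    qed
    have far: "?h x < ?h y" if "0 \<le> x" "y \<le> 1" "\<delta> / 2 \<le> y - x" for x y
    proof -
      have "2 * (\<delta> / (4 * (b - a))) = (\<delta> / 2) / (b - a)" using parameters by (simp add: field_simps)
      also have "\<dots> \<le> (y - x) / (b - a)" using that parameters by (intro divide_right_mono) auto
      also have "\<dots> = lin y - lin x" by (simp add: lin_def diff_divide_distrib)
      finally show ?thesis using near[of x] near[of y] that \<delta> by (auto simp: abs_less_iff)
    qed
    have weak: "?h x - ?h y \<le> 0" if "0 \<le> x" "x \<le> y" "y \<le> 1" for x y
    proof -
      let ?S = "{(x, y). 0 \<le> x \<and> x \<le> y \<and> y \<le> (1::real)}"
      have "(\<lambda>(x, y). ?h x - ?h y) (x, y) \<le> 0"
      proof (rule halving_nonpos[where S="?S" and M="2 * (1 / (1 - \<theta>))"])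
        fix z assume "z \<in> ?S"
        then obtain x y where z: "z = (x, y)" "0 \<le> x" "x \<le> y" "y \<le> 1" by auto
        then show "(\<lambda>(x, y). ?h x - ?h y) z \<le> 2 * (1 / (1 - \<theta>))"
          using semiconj_bound[OF abs \<theta>(1), of x] semiconj_bound[OF abs \<theta>(1), of y] by auto
      next
        fix e z assume e: "0 \<le> (e::real)" and le: "\<And>z. z \<in> ?S \<Longrightarrow> (\<lambda>(x, y). ?h x - ?h y) z \<le> e" and "z \<in> ?S"
        then obtain x y where z: "z = (x, y)" "0 \<le> x" "x \<le> y" "y \<le> 1" by auto
        have quarter: "?h x - ?h y \<le> e / 4" if g: "good k x y" and xy: "0 \<le> x" "x \<le> y" "y \<le> 1" for x y
        proof -
          let ?s = "pair_slope p q k x y" and ?s' = "pair_slope (1 / X) (1 / Y) k x y"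
          have T: "(T ^^ k) y - (T ^^ k) x = ?s * (y - x)" using T_good[OF g] xy by simp
          have H: "?h ((T ^^ k) y) - ?h ((T ^^ k) x) = ?s' * (?h y - ?h x)" using piece[OF g] xy by simp
          have u: "(T ^^ k) x \<in> {0..1}" "(T ^^ k) y \<in> {0..1}" using funpow_T_unit xy by auto
          \<comment> \<open>If T^k reverses orientation, so does the slope of h, and the bound e is
            applied to the images in reversed order.\<close>
          have "\<bar>?s'\<bar> * (?h x - ?h y) \<le> e"
          proof (cases "0 < ?s")
            case True
            then have "0 < ?s'" using sgn[of x y] by (simp add: zero_less_mult_iff)
            moreover have "0 \<le> ?s * (y - x)" using True xy by simp
            then have "(T ^^ k) x \<le> (T ^^ k) y" using T by linarith
            then have "?h ((T ^^ k) x) - ?h ((T ^^ k) y) \<le> e"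
              using le[of "((T ^^ k) x, (T ^^ k) y)"] u by simp
            ultimately show ?thesis using H by (simp add: algebra_simps)
          next
            case False
            then have "?s < 0" "?s' < 0" using sgn[of x y] by (auto simp: zero_less_mult_iff)
            moreover have "?s * (y - x) \<le> 0" using \<open>?s < 0\<close> xy by (simp add: mult_le_0_iff)
            then have "(T ^^ k) y \<le> (T ^^ k) x" using T by linarith
            then have "?h ((T ^^ k) y) - ?h ((T ^^ k) x) \<le> e"
              using le[of "((T ^^ k) y, (T ^^ k) x)"] u by simp
            ultimately show ?thesis using H by (simp add: algebra_simps)
          qed
          show ?thesis
          proof (cases "?h x - ?h y \<le> 0")
            case True then show ?thesis using e by simp
          next
            case False
            then have "4 * (?h x - ?h y) \<le> \<bar>?s'\<bar> * (?h x - ?h y)"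
              using S'[of x y] by (intro mult_right_mono) auto
            from order_trans[OF this \<open>\<bar>?s'\<bar> * (?h x - ?h y) \<le> e\<close>] show ?thesis by simp
          qed
        qed
        have "?h x - ?h y \<le> e / 2"
        proof (cases "y - x < \<delta>")
          case True
          then obtain m where "x \<le> m" "m \<le> y" "good k x m" "good k m y" using cut z by blast
          then show ?thesis using quarter[of x m] quarter[of m y] z by linarith
        next
          case False
          then show ?thesis using far[of x y] z \<delta> e by simp
        qed
        then show "(\<lambda>(x, y). ?h x - ?h y) z \<le> e / 2" using z by simp
      qed (use that in auto)
      then show ?thesis by simp
    qed
    have flat: "y - x \<le> 0" if "0 \<le> x" "x \<le> y" "y \<le> 1" "?h x = ?h y" for x y
    proof -
      let ?S = "{(x, y). 0 \<le> x \<and> x \<le> y \<and> y \<le> 1 \<and> ?h x = ?h y}"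
      have "(\<lambda>(x, y). y - x) (x, y) \<le> 0"
      proof (rule halving_nonpos[where S="?S" and M=1])
        fix e z assume e: "0 \<le> (e::real)" and le: "\<And>z. z \<in> ?S \<Longrightarrow> (\<lambda>(x, y). y - x) z \<le> e" and "z \<in> ?S"
        then obtain x y where z: "z = (x, y)" "0 \<le> x" "x \<le> y" "y \<le> 1" "?h x = ?h y" by auto
        have quarter: "y - x \<le> e / 4" if g: "good k x y" and xy: "0 \<le> x" "x \<le> y" "y \<le> 1" "?h x = ?h y" for x y
        proof -
          have H: "?h ((T ^^ k) y) = ?h ((T ^^ k) x)" using piece[OF g] xy by simp
          have u: "(T ^^ k) x \<in> {0..1}" "(T ^^ k) y \<in> {0..1}" using funpow_T_unit xy by auto
          have "\<bar>(T ^^ k) y - (T ^^ k) x\<bar> \<le> e"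
            using le[of "((T ^^ k) x, (T ^^ k) y)"] le[of "((T ^^ k) y, (T ^^ k) x)"] u H
            by (cases "(T ^^ k) x \<le> (T ^^ k) y") auto
          then have "\<bar>pair_slope p q k x y\<bar> * (y - x) \<le> e"
            using T_good[OF g] xy by (simp add: abs_mult)
          moreover have "4 * (y - x) \<le> \<bar>pair_slope p q k x y\<bar> * (y - x)"
            using S[of x y] xy by (intro mult_right_mono) auto
          ultimately have "4 * (y - x) \<le> e" by (rule order_trans[rotated])
          then show ?thesis by simp
        qed
        have "y - x < \<delta>" using far[of x y] z \<delta> by fastforce
        then obtain m where m: "x \<le> m" "m \<le> y" "good k x m" "good k m y" using cut z by blast
        \<comment> \<open>By \<open>weak\<close>, h is constant between x and y, so both pieces of
          the cut are flat.\<close>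
        then have "?h x = ?h m" "?h m = ?h y" using weak[of x m] weak[of m y] z by auto
        then show "(\<lambda>(x, y). y - x) z \<le> e / 2" using quarter[of x m] quarter[of m y] z m by simp
      qed (use that in auto)
      then show ?thesis by simp
    qed
    show ?thesis using weak[of x y] flat[of x y] xy by fastforce
  qed
  ultimately show thesis by (rule that)
qed

text \<open>H is an increasing conjugacy onto its image that matches the turning points, so the
  itineraries agree. For the bound on b', monotonicity is applied to the fixed point 0 and to T b: h
  0 = -X / (1 - X) \<le> 1 - 1 / Y amounts to X + Y \<ge> 1, and X + Y = 1 / b'.\<close>

lemma semiconj_strict_mono_imp_kneading_eq:
  assumes U': "0 < a'" "a' < 1" "a' < b'" "1 - a' < b'"
    and hb: "semiconj (a' / b') ((1 - a') / b') b = 1"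
    and mono: "\<And>x y. 0 \<le> x \<Longrightarrow> x < y \<Longrightarrow> y \<le> 1 \<Longrightarrow>
      semiconj (a' / b') ((1 - a') / b') x < semiconj (a' / b') ((1 - a') / b') y"
  shows "kneading a' b' = kneading a b" "b' \<le> 1"
proof -
  define X Y where "X = a' / b'" and "Y = (1 - a') / b'"
  have XY: "0 < X" "X < 1" "0 < Y" "Y < 1" using U' by (simp_all add: X_def Y_def)
  define h where "h = semiconj X Y"
  note hb = hb[folded X_def Y_def, folded h_def] and mono = mono[folded X_def Y_def, folded h_def]
  have ha: "h a = 0" using XY by (simp add: h_def)
  have left: "h (T x) = 1 + h x / X" if "0 \<le> x" "x \<le> a" for x
    unfolding h_def by (rule semiconj_step_left[OF XY hb[unfolded h_def] that])
  have right: "h (T x) = 1 - h x / Y" if "a \<le> x" "x \<le> 1" for x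
    unfolding h_def by (rule semiconj_step_right[OF XY hb[unfolded h_def] that])
  have neg: "h x < 0 \<longleftrightarrow> x < a" and zero: "h x = 0 \<longleftrightarrow> x = a" if "x \<in> {0..1}" for x
  proof -
    have "x < a \<Longrightarrow> h x < 0" using mono[of x a] ha that parameters(2) by simp
    moreover have "a < x \<Longrightarrow> 0 < h x" using mono[of a x] ha that parameters(1) by simp
    ultimately show "h x < 0 \<longleftrightarrow> x < a" "h x = 0 \<longleftrightarrow> x = a"
      using ha by (cases x a rule: linorder_cases; simp)+
  qed
  define H where "H x = a' + (b' - a') * h x" for x
  have conj: "skew_tent a' b' (H x) = H (T x)" if x: "x \<in> {0..1}" for x
  proof (cases "x \<le> a")
    case True
    then have "h x \<le> 0" using neg[OF x] zero[OF x] by linarith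
    then have "H x \<le> a'" using U' by (simp add: H_def mult_le_0_iff)
    then have "skew_tent a' b' (H x) = (b' / a') * (a' + (b' - a') * h x)"
      by (simp add: skew_tent_def H_def)
    also have "\<dots> = a' + (b' - a') * (1 + h x / X)"
    proof -
      have "h x / X = (b' / a') * h x" "(b' / a') * a' = b'" using U' by (simp_all add: X_def)
      then show ?thesis by (simp only:) (simp only: distrib_left mult.left_commute, simp)
    qed
    finally show ?thesis using left[of x] True x by (simp add: H_def)
  next
    case False
    then have "0 < h x" using neg[OF x] zero[OF x] by linarith
    then have "\<not> H x \<le> a'" using U' by (simp add: H_def mult_le_0_iff)
    then have "skew_tent a' b' (H x) = (b' / (1 - a')) * (1 - (a' + (b' - a') * h x))"
      by (simp add: skew_tent_def H_def)
    also have "\<dots> = a' + (b' - a') * (1 - h x / Y)"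
    proof -
      have "h x / Y = (b' / (1 - a')) * h x" using U' by (simp add: Y_def)
      moreover have "(b' / (1 - a')) * (1 - (a' + (b' - a') * h x))
          = (b' / (1 - a')) * (1 - a') - (b' - a') * ((b' / (1 - a')) * h x)"
        by (simp only: right_diff_distrib distrib_left mult.left_commute diff_diff_add)
      moreover have "(b' / (1 - a')) * (1 - a') = b'" using U' by simp
      ultimately show ?thesis by (simp only: right_diff_distrib) simp
    qed
    finally show ?thesis using right[of x] False x by (simp add: H_def)
  qed
  have orbit: "(skew_tent a' b' ^^ n) a' = H ((T ^^ n) a)" for n
  proof (induction n)
    case 0
    then show ?case by (simp add: H_def ha)
  next
    case (Suc n)
    then show ?case using conj[OF funpow_T_unit[OF turning_unit(1), of n]] by simp
  qed
  have "ext_kneading a' b' n = ext_kneading a b n" for n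
  proof -
    let ?x = "(T ^^ n) a"
    have "H ?x < a' \<longleftrightarrow> ?x < a" "H ?x = a' \<longleftrightarrow> ?x = a"
      using neg[OF funpow_T_unit[OF turning_unit(1), of n]] zero[OF funpow_T_unit[OF turning_unit(1), of n]] U'
      by (auto simp: H_def mult_less_0_iff)
    then show ?thesis unfolding ext_kneading_def orbit Let_def by simp
  qed
  then have "ext_kneading a' b' = ext_kneading a b" by (rule ext)
  then show "kneading a' b' = kneading a b" unfolding kneading_def by (simp only:)
  have "T 0 = 0" using parameters by (simp add: skew_tent_def)
  then have "h 0 = 1 + h 0 / X" using left[of 0] parameters by simp
  then have h0: "h 0 = - X / (1 - X)" using XY by (simp add: field_simps)
  have "h 0 \<le> h (T b)"
    using mono[of 0 "T b"] T_unit[OF turning_unit(2)] by (cases "T b = 0") auto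
  then have "- X / (1 - X) \<le> 1 - 1 / Y" using right[of b] hb h0 parameters by simp
  then have "1 / Y \<le> 1 / (1 - X)" using XY by (simp add: field_simps)
  then have "1 \<le> X + Y" using XY by (simp add: divide_simps split: if_splits)
  then show "b' \<le> 1" using U' by (simp add: X_def Y_def add_divide_distrib[symmetric])
qed

section \<open>The isentrope as a level set near the base parameter\<close>

lemma tendsto_semiconj:
  assumes f: "(f \<longlongrightarrow> X) F" and g: "(g \<longlongrightarrow> Y) F" and XY: "\<bar>X\<bar> < 1" "\<bar>Y\<bar> < 1" and x: "x \<in> {0..1}"
  shows "((\<lambda>t. semiconj (f t) (g t) x) \<longlongrightarrow> semiconj X Y x) F"
proof -
  obtain \<theta> where \<theta>: "max \<bar>X\<bar> \<bar>Y\<bar> < \<theta>" "\<theta> < 1" using XY dense[of "max \<bar>X\<bar> \<bar>Y\<bar>" 1] by auto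
  let ?c = "1 + 1 / (1 - \<theta>)"
  have "\<forall>\<^sub>F t in F. \<bar>f t\<bar> < \<theta>" "\<forall>\<^sub>F t in F. \<bar>g t\<bar> < \<theta>"
    using order_tendstoD(2)[OF tendsto_rabs[OF f]] order_tendstoD(2)[OF tendsto_rabs[OF g]] \<theta> by auto
  then have "\<forall>\<^sub>F t in F. norm (semiconj (f t) (g t) x - semiconj X Y x)
      \<le> (\<bar>f t - X\<bar> + \<bar>g t - Y\<bar>) * ?c / (1 - \<theta>)"
  proof eventually_elim
    case (elim t)
    then show ?case unfolding real_norm_def by (intro semiconj_lipschitz x) (use \<theta> in auto)
  qed
  moreover have "((\<lambda>t. (\<bar>f t - X\<bar> + \<bar>g t - Y\<bar>) * ?c / (1 - \<theta>)) \<longlongrightarrow> (\<bar>X - X\<bar> + \<bar>Y - Y\<bar>) * ?c / (1 - \<theta>)) F"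
    by (intro tendsto_intros f g) (use \<theta> in simp)
  then have "((\<lambda>t. (\<bar>f t - X\<bar> + \<bar>g t - Y\<bar>) * ?c / (1 - \<theta>)) \<longlongrightarrow> 0) F" by simp
  ultimately have "((\<lambda>t. semiconj (f t) (g t) x - semiconj X Y x) \<longlongrightarrow> 0) F"
    by (rule Lim_null_comparison)
  then show ?thesis by (rule LIM_zero_cancel)
qed

text \<open>Near \<open>(a, b)\<close>, the isentrope is the level set of this function at \<open>1\<close>.\<close>
definition kneading_fun :: "real \<Rightarrow> real \<Rightarrow> real" where
  "kneading_fun \<alpha> \<beta> = semiconj (\<alpha> / \<beta>) ((1 - \<alpha>) / \<beta>) b"

lemma tendsto_kneading_fun:
  assumes "(f \<longlongrightarrow> \<alpha>) F" "(g \<longlongrightarrow> \<beta>) F" "0 < \<alpha>" "\<alpha> < 1" "\<alpha> < \<beta>" "1 - \<alpha> < \<beta>"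
  shows "((\<lambda>t. kneading_fun (f t) (g t)) \<longlongrightarrow> kneading_fun \<alpha> \<beta>) F"
  unfolding kneading_fun_def
  by (intro tendsto_semiconj tendsto_intros assms) (use assms turning_unit in \<open>simp_all\<close>)

text \<open>Local converse of \<open>kneading_eq_imp_semiconj\<close>. Closeness provides strict
  monotonicity and the open conditions of \<open>U_region\<close>; the bound \<beta> \<le> 1 is a
  consequence of the conjugacy.\<close>

lemma kneading_fun_zero_imp_kneading_eq:
  obtains \<eta> where "0 < \<eta>"
    "\<And>\<alpha> \<beta>. \<bar>\<alpha> - a\<bar> < \<eta> \<Longrightarrow> \<bar>\<beta> - b\<bar> < \<eta> \<Longrightarrow> kneading_fun \<alpha> \<beta> = 1 \<Longrightarrow>
       (\<alpha>, \<beta>) \<in> U_region \<and> kneading \<alpha> \<beta> = kneading a b"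
proof -
  obtain \<eta> where \<eta>: "0 < \<eta>" and mono:
    "\<And>X Y x y. \<bar>X - 1 / p\<bar> < \<eta> \<Longrightarrow> \<bar>Y - 1 / q\<bar> < \<eta> \<Longrightarrow> semiconj X Y b = 1 \<Longrightarrow>
       0 \<le> x \<Longrightarrow> x < y \<Longrightarrow> y \<le> 1 \<Longrightarrow> semiconj X Y x < semiconj X Y y"
    using semiconj_strict_mono by blast
  have fst: "(fst \<longlongrightarrow> a) (nhds (a, b))" and snd: "(snd \<longlongrightarrow> b) (nhds (a, b))"
    using tendsto_fst[OF filterlim_ident, of "(a, b)"] tendsto_snd[OF filterlim_ident, of "(a, b)"] by simp_all
  have pq: "1 / p = a / b" "1 / q = (1 - a) / b" by (simp_all add: p_def q_def)
  have X: "((\<lambda>z. fst z / snd z) \<longlongrightarrow> 1 / p) (nhds (a, b))" and Y: "((\<lambda>z. (1 - fst z) / snd z) \<longlongrightarrow> 1 / q) (nhds (a, b))"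
    unfolding pq using parameters by (intro tendsto_intros fst snd; simp)+
  have "\<forall>\<^sub>F z in nhds (a, b). \<bar>fst z / snd z - 1 / p\<bar> < \<eta>" "\<forall>\<^sub>F z in nhds (a, b). \<bar>(1 - fst z) / snd z - 1 / q\<bar> < \<eta>"
    using tendstoD[OF X \<eta>] tendstoD[OF Y \<eta>] by (simp_all add: dist_real_def)
  moreover have "\<forall>\<^sub>F z in nhds (a, b). 0 < fst z" "\<forall>\<^sub>F z in nhds (a, b). fst z < 1" "\<forall>\<^sub>F z in nhds (a, b). 1 / 2 < snd z"
    by (rule order_tendstoD(1)[OF fst parameters(1)], rule order_tendstoD(2)[OF fst parameters(2)],
        rule order_tendstoD(1)[OF snd parameters(3)])
  moreover have "\<forall>\<^sub>F z in nhds (a, b). 0 < snd z - fst z" "\<forall>\<^sub>F z in nhds (a, b). 0 < snd z - (1 - fst z)"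
    using order_tendstoD(1)[OF tendsto_diff[OF snd fst], of 0]
      order_tendstoD(1)[OF tendsto_diff[OF snd tendsto_diff[OF tendsto_const fst]], of 0] parameters by auto
  ultimately have "\<forall>\<^sub>F z in nhds (a, b). kneading_fun (fst z) (snd z) = 1 \<longrightarrow>
      z \<in> U_region \<and> kneading (fst z) (snd z) = kneading a b"
  proof eventually_elim
    case (elim z)
    show ?case
    proof
      assume "kneading_fun (fst z) (snd z) = 1"
      then have h: "semiconj (fst z / snd z) ((1 - fst z) / snd z) b = 1" by (simp add: kneading_fun_def)
      have "kneading (fst z) (snd z) = kneading a b" "snd z \<le> 1"
        using semiconj_strict_mono_imp_kneading_eq[of "fst z" "snd z", OF _ _ _ _ h mono[OF elim(1,2) h]] elim
        by simp_all
      then show "z \<in> U_region \<and> kneading (fst z) (snd z) = kneading a b"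
        using elim by (simp add: U_region_def case_prod_unfold)
    qed
  qed
  then obtain e where e: "0 < e" and E: "\<And>z. dist z (a, b) < e \<Longrightarrow> kneading_fun (fst z) (snd z) = 1 \<Longrightarrow>
      z \<in> U_region \<and> kneading (fst z) (snd z) = kneading a b"
    unfolding eventually_nhds_metric by blast
  show thesis
  proof (rule that[of "e / 2"])
    fix \<alpha> \<beta> assume "\<bar>\<alpha> - a\<bar> < e / 2" "\<bar>\<beta> - b\<bar> < e / 2" and k: "kneading_fun \<alpha> \<beta> = 1"
    then have "dist (\<alpha>, \<beta>) (a, b) < e"
      using sqrt_sum_squares_le_sum_abs[of "\<alpha> - a" "\<beta> - b"] by (simp add: dist_Pair_Pair dist_real_def)
    then show "(\<alpha>, \<beta>) \<in> U_region \<and> kneading \<alpha> \<beta> = kneading a b"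
      using E[of "(\<alpha>, \<beta>)"] k by simp
  qed (use e in simp)
qed

lemma kneading_fun_expansion:
  obtains c where "0 < c"
    "\<forall>\<^sub>F z in nhds (a, b). \<bar>kneading_fun (fst z) (snd z) - 1
        + (1 - p * (fst z / snd z)) * vL b + (1 - q * ((1 - fst z) / snd z)) * vR b\<bar>
      \<le> (\<bar>1 - p * (fst z / snd z)\<bar> + \<bar>1 - q * ((1 - fst z) / snd z)\<bar>)\<^sup>2 * c"
proof -
  obtain \<theta> where \<theta>: "1 / r < \<theta>" "\<theta> < 1" using dense[OF inv_r(2)] by blast
  have fst: "(fst \<longlongrightarrow> a) (nhds (a, b))" and snd: "(snd \<longlongrightarrow> b) (nhds (a, b))"
    using tendsto_fst[OF filterlim_ident, of "(a, b)"] tendsto_snd[OF filterlim_ident, of "(a, b)"] by simp_all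
  have pq: "1 / p = a / b" "1 / q = (1 - a) / b" by (simp_all add: p_def q_def)
  have X: "((\<lambda>z. fst z / snd z) \<longlongrightarrow> 1 / p) (nhds (a, b))" and Y: "((\<lambda>z. (1 - fst z) / snd z) \<longlongrightarrow> 1 / q) (nhds (a, b))"
    unfolding pq using parameters by (intro tendsto_intros fst snd; simp)+
  have lt: "\<bar>1 / p\<bar> < \<theta>" "\<bar>1 / q\<bar> < \<theta>" by (rule le_less_trans[OF inv_r(3) \<theta>(1)], rule le_less_trans[OF inv_r(4) \<theta>(1)])
  have "\<forall>\<^sub>F z in nhds (a, b). \<bar>fst z / snd z\<bar> < \<theta>" "\<forall>\<^sub>F z in nhds (a, b). \<bar>(1 - fst z) / snd z\<bar> < \<theta>"
    using order_tendstoD(2)[OF tendsto_rabs[OF X] lt(1)] order_tendstoD(2)[OF tendsto_rabs[OF Y] lt(2)] .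
  then have "\<forall>\<^sub>F z in nhds (a, b). \<bar>kneading_fun (fst z) (snd z) - 1
        + (1 - p * (fst z / snd z)) * vL b + (1 - q * ((1 - fst z) / snd z)) * vR b\<bar>
      \<le> (\<bar>1 - p * (fst z / snd z)\<bar> + \<bar>1 - q * ((1 - fst z) / snd z)\<bar>)\<^sup>2 * (1 / (b - a) / (1 - 1 / r) / (1 - \<theta>))"
  proof eventually_elim
    case (elim z)
    show ?case
      using semiconj_expansion[OF less_imp_le[OF elim(1)] less_imp_le[OF elim(2)] less_imp_le[OF \<theta>(1)] \<theta>(2) turning_unit(2)]
      unfolding kneading_fun_def lin_turning times_divide_eq_right .
  qed
  moreover have "0 < 1 / (b - a) / (1 - 1 / r) / (1 - \<theta>)"
    using parameters inv_r \<theta> by (intro divide_pos_pos) auto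
  ultimately show thesis using that by blast
qed

text \<open>For \<alpha> = a both relative changes equal e = 1 - b / \<beta>. The expansion then has
  leading term -(A + B) * e and an error of at most 4 * c * e^2, which is dominated for \<beta>
  close to b; and e has the sign of \<beta> - b.\<close>

lemma kneading_fun_sign:
  assumes "vL b + vR b \<noteq> 0"
  shows "\<forall>\<^sub>F \<beta> in at b. (kneading_fun a \<beta> - 1) * (vL b + vR b) * (\<beta> - b) < 0"
proof -
  define s where "s = vL b + vR b"
  have "0 < \<bar>s\<bar>" using assms by (simp add: s_def)
  obtain c where c: "0 < c" and ev: "\<forall>\<^sub>F z in nhds (a, b). \<bar>kneading_fun (fst z) (snd z) - 1
        + (1 - p * (fst z / snd z)) * vL b + (1 - q * ((1 - fst z) / snd z)) * vR b\<bar>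
      \<le> (\<bar>1 - p * (fst z / snd z)\<bar> + \<bar>1 - q * ((1 - fst z) / snd z)\<bar>)\<^sup>2 * c"
    using kneading_fun_expansion by blast
  have "((\<lambda>\<beta>. (a, \<beta>)) \<longlongrightarrow> (a, b)) (at b)" by (intro tendsto_intros)
  from eventually_compose_filterlim[OF ev this]
  have "\<forall>\<^sub>F \<beta> in at b. \<bar>kneading_fun a \<beta> - 1 + (1 - p * (a / \<beta>)) * vL b + (1 - q * ((1 - a) / \<beta>)) * vR b\<bar>
      \<le> (\<bar>1 - p * (a / \<beta>)\<bar> + \<bar>1 - q * ((1 - a) / \<beta>)\<bar>)\<^sup>2 * c"
    by (simp only: fst_conv snd_conv)
  moreover have "((\<lambda>\<beta>. 4 * c * \<bar>1 - b / \<beta>\<bar>) \<longlongrightarrow> 4 * c * \<bar>1 - b / b\<bar>) (at b)"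
    using parameters by (intro tendsto_intros) auto
  then have "\<forall>\<^sub>F \<beta> in at b. 4 * c * \<bar>1 - b / \<beta>\<bar> < \<bar>s\<bar>"
    using \<open>0 < \<bar>s\<bar>\<close> parameters by (intro order_tendstoD(2)) auto
  moreover have "\<forall>\<^sub>F \<beta> in at b. 0 < \<beta>"
    using parameters by (intro order_tendstoD(1)[OF tendsto_ident_at]) auto
  moreover have "\<forall>\<^sub>F \<beta> in at b. \<beta> \<noteq> b" by (rule eventually_neq_at_within)
  ultimately show ?thesis
  proof eventually_elim
    case (elim \<beta>)
    define e where "e = 1 - b / \<beta>"
    define g where "g = kneading_fun a \<beta> - 1"
    have "1 - p * (a / \<beta>) = e" "1 - q * ((1 - a) / \<beta>) = e"
      using parameters by (simp_all add: p_def q_def e_def)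
    then have "\<bar>g + e * vL b + e * vR b\<bar> \<le> (\<bar>e\<bar> + \<bar>e\<bar>)\<^sup>2 * c"
      using elim(1) by (simp add: g_def)
    moreover have "g + e * vL b + e * vR b = g + e * s" by (simp add: s_def algebra_simps)
    moreover have "(\<bar>e\<bar> + \<bar>e\<bar>)\<^sup>2 * c = \<bar>e\<bar> * (4 * c * \<bar>e\<bar>)" by (simp add: power2_eq_square)
    ultimately have gs: "\<bar>g + e * s\<bar> \<le> \<bar>e\<bar> * (4 * c * \<bar>e\<bar>)" by (simp only:)
    have e: "e = (\<beta> - b) / \<beta>" "e \<noteq> 0" using elim(3,4) by (simp_all add: e_def field_simps)
    have "\<bar>e\<bar> * (4 * c * \<bar>e\<bar>) < \<bar>e\<bar> * \<bar>s\<bar>"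
      using elim(2) e(2) by (intro mult_strict_left_mono) (simp_all add: e_def)
    then have lt: "\<bar>g + e * s\<bar> < \<bar>e * s\<bar>" using gs by (simp add: abs_mult)
    have "g * (e * s) < 0"
    proof (cases "0 < e * s")
      case True
      then have "g < 0" using lt by linarith
      then show ?thesis using True by (simp add: mult_neg_pos)
    next
      case False
      then have "e * s < 0" "0 < g" using lt by linarith+
      then show ?thesis by (simp add: mult_pos_neg)
    qed
    then have "\<beta> * (g * (e * s)) < 0" by (rule mult_pos_neg[OF elim(3)])
    moreover have "\<beta> - b = \<beta> * e" using elim(3) by (simp add: e(1))
    ultimately have "g * s * (\<beta> - b) < 0" by (simp only: mult_ac)
    then show ?case by (simp only: g_def s_def)
  qed
qed

text \<open>Intermediate value theorem in \<beta>: the opposite signs at b - t and b + t, known for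
  \<alpha> = a, persist for nearby \<alpha> by continuity.\<close>

lemma kneading_fun_zero_exists:
  assumes nz: "vL b + vR b \<noteq> 0" and "0 < \<epsilon>"
  shows "\<forall>\<^sub>F \<alpha> in nhds a. \<exists>\<beta>. \<bar>\<beta> - b\<bar> < \<epsilon> \<and> kneading_fun \<alpha> \<beta> = 1"
proof -
  define s where "s = vL b + vR b"
  obtain d where d: "0 < d" and D: "\<And>\<beta>. \<beta> \<noteq> b \<Longrightarrow> dist \<beta> b < d \<Longrightarrow> (kneading_fun a \<beta> - 1) * s * (\<beta> - b) < 0"
    using kneading_fun_sign[OF nz] unfolding eventually_at s_def by blast
  define t where "t = min (min d \<epsilon>) (min (b - a) (b - (1 - a))) / 2"
  have t: "0 < t" "t < d" "t < \<epsilon>" "t < b - a" "t < b - (1 - a)"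
    using d \<open>0 < \<epsilon>\<close> parameters by (auto simp: t_def)
  \<comment> \<open>The factor s lets the sign change go from positive to negative whatever the sign
    of A + B.\<close>
  define f where "f \<alpha> \<beta> = (kneading_fun \<alpha> \<beta> - 1) * s" for \<alpha> \<beta>
  have "f a (b + t) * t < 0" "f a (b - t) * (- t) < 0"
    using D[of "b + t"] D[of "b - t"] t by (simp_all add: dist_real_def f_def)
  then have f0: "f a (b + t) < 0" "0 < f a (b - t)"
    using t by (simp_all add: mult_less_0_iff zero_less_mult_iff)
  have lim: "((\<lambda>\<alpha>. f \<alpha> (b + t)) \<longlongrightarrow> f a (b + t)) (nhds a)" "((\<lambda>\<alpha>. f \<alpha> (b - t)) \<longlongrightarrow> f a (b - t)) (nhds a)"
    unfolding f_def using parameters t by (intro tendsto_intros tendsto_kneading_fun filterlim_ident; simp)+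
  have "\<forall>\<^sub>F \<alpha> in nhds a. 0 < \<alpha>" "\<forall>\<^sub>F \<alpha> in nhds a. \<alpha> < 1" "\<forall>\<^sub>F \<alpha> in nhds a. \<alpha> < b - t" "\<forall>\<^sub>F \<alpha> in nhds a. 1 - (b - t) < \<alpha>"
    using parameters t order_tendstoD[OF filterlim_ident[of "nhds a"]] by auto
  with order_tendstoD(2)[OF lim(1) f0(1)] order_tendstoD(1)[OF lim(2) f0(2)]
  show ?thesis
  proof eventually_elim
    case (elim \<alpha>)
    have "continuous_on {b - t..b + t} (f \<alpha>)"
      unfolding continuous_on_def
    proof
      fix \<beta> assume "\<beta> \<in> {b - t..b + t}"
      then show "(f \<alpha> \<longlongrightarrow> f \<alpha> \<beta>) (at \<beta> within {b - t..b + t})"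
        unfolding f_def using elim by (intro tendsto_intros tendsto_kneading_fun) auto
    qed
    then obtain \<beta> where "b - t \<le> \<beta>" "\<beta> \<le> b + t" "f \<alpha> \<beta> = 0"
      using IVT2'[of "f \<alpha>" "b + t" 0 "b - t"] elim t by auto
    then show ?case using t nz by (intro exI[of _ \<beta>]) (auto simp: f_def s_def)
  qed
qed

text \<open>Each of the two candidates serves as base parameter in turn, and
  \<open>kneading_inj_above\<close> gives one inequality each time.\<close>

lemma isentrope_eq:
  assumes "(\<alpha>, \<beta>) \<in> U_region" "kneading \<alpha> \<beta> = M"
  shows "isentrope M \<alpha> = \<beta>"
  unfolding isentrope_def
proof (rule the_equality)
  fix \<beta>' assume \<beta>': "(\<alpha>, \<beta>') \<in> U_region \<and> kneading \<alpha> \<beta>' = M"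
  interpret A: skew_tent_map \<alpha> \<beta> by unfold_locales (rule assms)
  interpret B: skew_tent_map \<alpha> \<beta>' by unfold_locales (use \<beta>' in simp)
  show "\<beta>' = \<beta>"
  proof (rule order.antisym)
    show "\<beta>' \<le> \<beta>" by (rule A.kneading_inj_above) (use \<beta>' assms in simp_all)
    show "\<beta> \<le> \<beta>'" by (rule B.kneading_inj_above) (use \<beta>' assms in simp_all)
  qed
qed (use assms in simp)

text \<open>The solution found by the intermediate value theorem has the right kneading sequence, so
  uniqueness identifies it with the definite description. As \<epsilon> is arbitrary, this contains
  the continuity of the isentrope at a.\<close>

lemma isentrope_near:
  assumes nz: "vL b + vR b \<noteq> 0" and "0 < \<epsilon>"
  shows "\<forall>\<^sub>F \<alpha> in nhds a. \<bar>isentrope (kneading a b) \<alpha> - b\<bar> < \<epsilon> \<and>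
    kneading_fun \<alpha> (isentrope (kneading a b) \<alpha>) = 1"
proof -
  obtain \<eta> where \<eta>: "0 < \<eta>" and zero: "\<And>\<alpha> \<beta>. \<bar>\<alpha> - a\<bar> < \<eta> \<Longrightarrow> \<bar>\<beta> - b\<bar> < \<eta> \<Longrightarrow> kneading_fun \<alpha> \<beta> = 1 \<Longrightarrow>
       (\<alpha>, \<beta>) \<in> U_region \<and> kneading \<alpha> \<beta> = kneading a b"
    using kneading_fun_zero_imp_kneading_eq by blast
  have "\<forall>\<^sub>F \<alpha> in nhds a. \<exists>\<beta>. \<bar>\<beta> - b\<bar> < min \<epsilon> \<eta> \<and> kneading_fun \<alpha> \<beta> = 1"
    using \<eta> \<open>0 < \<epsilon>\<close> by (intro kneading_fun_zero_exists nz) simp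
  moreover have "\<forall>\<^sub>F \<alpha> in nhds a. \<bar>\<alpha> - a\<bar> < \<eta>"
    using tendstoD[OF filterlim_ident \<eta>, of a] by (simp add: dist_real_def)
  ultimately show ?thesis
  proof eventually_elim
    case (elim \<alpha>)
    then obtain \<beta> where \<beta>: "\<bar>\<beta> - b\<bar> < \<epsilon>" "\<bar>\<beta> - b\<bar> < \<eta>" "kneading_fun \<alpha> \<beta> = 1" by auto
    then have "isentrope (kneading a b) \<alpha> = \<beta>"
      using zero[OF elim(2) \<beta>(2,3)] by (intro isentrope_eq) simp_all
    then show ?case using \<beta> by simp
  qed
qed

text \<open>Implicit differentiation by hand: on the isentrope e * A + f * B is of second order.
  Multiplication by y = \<psi> \<alpha> makes e and f affine in the increments of \<alpha> and y,
  which yields the derivative (p * A - q * B) / (A + B).\<close>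

lemma isentrope_has_derivative:
  assumes nz: "vL b + vR b \<noteq> 0"
  defines "\<gamma> \<equiv> vL b / (vL b + vR b)"
  shows "(isentrope (kneading a b) has_real_derivative b * (\<gamma> / a - (1 - \<gamma>) / (1 - a))) (at a)"
proof -
  define \<psi> where "\<psi> = isentrope (kneading a b)"
  define s where "s = vL b + vR b"
  define D where "D = b * (\<gamma> / a - (1 - \<gamma>) / (1 - a))"
  have le: "at a \<le> nhds a" by (simp add: at_within_def)
  have \<psi>a: "\<psi> a = b" unfolding \<psi>_def by (rule isentrope_eq[OF in_U refl])
  have near: "\<forall>\<^sub>F \<alpha> in nhds a. \<bar>\<psi> \<alpha> - b\<bar> < \<epsilon> \<and> kneading_fun \<alpha> (\<psi> \<alpha>) = 1" if "0 < \<epsilon>" for \<epsilon>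
    unfolding \<psi>_def by (rule isentrope_near[OF nz that])
  have lim: "(\<psi> \<longlongrightarrow> b) (nhds a)"
  proof (rule tendstoI)
    fix \<epsilon> :: real assume "0 < \<epsilon>"
    from near[OF this] show "\<forall>\<^sub>F \<alpha> in nhds a. dist (\<psi> \<alpha>) b < \<epsilon>"
      by eventually_elim (simp add: dist_real_def)
  qed
  obtain c where c: "0 < c" and ev: "\<forall>\<^sub>F z in nhds (a, b). \<bar>kneading_fun (fst z) (snd z) - 1
        + (1 - p * (fst z / snd z)) * vL b + (1 - q * ((1 - fst z) / snd z)) * vR b\<bar>
      \<le> (\<bar>1 - p * (fst z / snd z)\<bar> + \<bar>1 - q * ((1 - fst z) / snd z)\<bar>)\<^sup>2 * c"
    using kneading_fun_expansion by blast
  have "((\<lambda>\<alpha>. (\<alpha>, \<psi> \<alpha>)) \<longlongrightarrow> (a, b)) (nhds a)" by (intro tendsto_intros lim filterlim_ident)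
  from eventually_compose_filterlim[OF ev this]
  have "\<forall>\<^sub>F \<alpha> in nhds a. \<bar>kneading_fun \<alpha> (\<psi> \<alpha>) - 1 + (1 - p * (\<alpha> / \<psi> \<alpha>)) * vL b + (1 - q * ((1 - \<alpha>) / \<psi> \<alpha>)) * vR b\<bar>
      \<le> (\<bar>1 - p * (\<alpha> / \<psi> \<alpha>)\<bar> + \<bar>1 - q * ((1 - \<alpha>) / \<psi> \<alpha>)\<bar>)\<^sup>2 * c"
    by (simp only: fst_conv snd_conv)
  moreover have "\<forall>\<^sub>F \<alpha> in nhds a. 1 / 2 < \<psi> \<alpha>" by (rule order_tendstoD(1)[OF lim parameters(3)])
  moreover have "\<forall>\<^sub>F \<alpha> in nhds a. \<bar>\<psi> \<alpha> - b\<bar> < 1 \<and> kneading_fun \<alpha> (\<psi> \<alpha>) = 1" by (rule near) simp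
  ultimately have "\<forall>\<^sub>F \<alpha> in nhds a. \<bar>\<psi> \<alpha> - \<psi> a - D * (\<alpha> - a)\<bar> \<le> (2 * c * (p + q)\<^sup>2 / \<bar>s\<bar>) * (\<bar>\<psi> \<alpha> - \<psi> a\<bar> + \<bar>\<alpha> - a\<bar>)\<^sup>2"
  proof eventually_elim
    case (elim \<alpha>)
    define y where "y = \<psi> \<alpha>"
    define e where "e = 1 - p * (\<alpha> / y)"
    define f where "f = 1 - q * ((1 - \<alpha>) / y)"
    have y: "1 / 2 < y" using elim(2) by (simp add: y_def)
    have E: "\<bar>e * vL b + f * vR b\<bar> \<le> (\<bar>e\<bar> + \<bar>f\<bar>)\<^sup>2 * c"
      using elim(1,3) by (simp add: y_def e_def f_def)
    have ye: "y * e = (y - b) - p * (\<alpha> - a)" and yf: "y * f = (y - b) + q * (\<alpha> - a)"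
    proof -
      have "p * a = b" "q * (1 - a) = b" using parameters by (simp_all add: p_def q_def)
      moreover have "y * (1 - c * (d / y)) = y - c * d" for c d
        using y by (simp add: field_simps)
      then have "y * e = y - p * \<alpha>" "y * f = y - q * (1 - \<alpha>)"
        unfolding e_def f_def by blast+
      ultimately show "y * e = (y - b) - p * (\<alpha> - a)" "y * f = (y - b) + q * (\<alpha> - a)"
        by (simp_all add: algebra_simps)
    qed
    have "s * (y - b - D * (\<alpha> - a)) = y * (e * vL b + f * vR b)"
    proof -
      have "s * \<gamma> = vL b" "s * (1 - \<gamma>) = vR b"
        using nz by (simp_all add: \<gamma>_def s_def right_diff_distrib)
      moreover have "s * (D * (\<alpha> - a)) = p * (s * \<gamma>) * (\<alpha> - a) - q * (s * (1 - \<gamma>)) * (\<alpha> - a)"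
        by (simp add: D_def p_def q_def algebra_simps)
      ultimately have "s * (y - b - D * (\<alpha> - a)) = s * (y - b) - (p * vL b * (\<alpha> - a) - q * vR b * (\<alpha> - a))"
        by (simp add: right_diff_distrib)
      also have "\<dots> = (y * e) * vL b + (y * f) * vR b"
        unfolding ye yf s_def by (simp add: algebra_simps)
      finally show ?thesis by (simp add: algebra_simps)
    qed
    then have "\<bar>s\<bar> * \<bar>y - b - D * (\<alpha> - a)\<bar> = y * \<bar>e * vL b + f * vR b\<bar>"
      using y by (simp add: abs_mult[symmetric]) (simp add: abs_mult)
    also have "\<dots> \<le> y * ((\<bar>e\<bar> + \<bar>f\<bar>)\<^sup>2 * c)" using E y by (intro mult_left_mono) auto
    \<comment> \<open>As 2 * y \<ge> 1, the inserted factor completes y * y, so that y can move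
      inside the square.\<close>
    also have "\<dots> \<le> (2 * y) * (y * ((\<bar>e\<bar> + \<bar>f\<bar>)\<^sup>2 * c))"
      using y c mult_right_mono[of 1 "2 * y" "y * ((\<bar>e\<bar> + \<bar>f\<bar>)\<^sup>2 * c)"] by simp
    also have "\<dots> = 2 * c * (\<bar>y * e\<bar> + \<bar>y * f\<bar>)\<^sup>2"
      using y by (simp add: abs_mult power2_eq_square algebra_simps)
    also have "\<dots> \<le> 2 * c * ((p + q) * (\<bar>y - b\<bar> + \<bar>\<alpha> - a\<bar>))\<^sup>2"
    proof (intro mult_left_mono power_mono)
      have "\<bar>y * e\<bar> \<le> \<bar>y - b\<bar> + p * \<bar>\<alpha> - a\<bar>" "\<bar>y * f\<bar> \<le> \<bar>y - b\<bar> + q * \<bar>\<alpha> - a\<bar>"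
        unfolding ye yf using abs_triangle_ineq4[of "y - b" "p * (\<alpha> - a)"] abs_triangle_ineq[of "y - b" "q * (\<alpha> - a)"] slopes
        by (simp_all add: abs_mult)
      moreover have "2 * \<bar>y - b\<bar> \<le> (p + q) * \<bar>y - b\<bar>" using slopes by (intro mult_right_mono) auto
      ultimately show "\<bar>y * e\<bar> + \<bar>y * f\<bar> \<le> (p + q) * (\<bar>y - b\<bar> + \<bar>\<alpha> - a\<bar>)"
        by (simp add: algebra_simps)
    qed (use c in auto)
    finally have "\<bar>s\<bar> * \<bar>y - b - D * (\<alpha> - a)\<bar> \<le> 2 * c * (p + q)\<^sup>2 * (\<bar>y - b\<bar> + \<bar>\<alpha> - a\<bar>)\<^sup>2"
      by (simp add: power_mult_distrib)
    moreover have "0 < \<bar>s\<bar>" using nz by (simp add: s_def)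
    ultimately show ?case unfolding \<psi>a y_def[symmetric] by (simp add: field_simps)
  qed
  then have "\<forall>\<^sub>F \<alpha> in at a. \<bar>\<psi> \<alpha> - \<psi> a - D * (\<alpha> - a)\<bar> \<le> (2 * c * (p + q)\<^sup>2 / \<bar>s\<bar>) * (\<bar>\<psi> \<alpha> - \<psi> a\<bar> + \<bar>\<alpha> - a\<bar>)\<^sup>2"
    by (rule filter_leD[OF le])
  moreover have "(\<psi> \<longlongrightarrow> \<psi> a) (at a)" using tendsto_mono[OF le lim] \<psi>a by simp
  ultimately have "(\<psi> has_real_derivative D) (at a)" by (intro has_derivative_quadratic_error)
  then show ?thesis unfolding \<psi>_def D_def .
qed

end

theorem theorem1p2:
  fixes a0 b0 :: real and \<mu> :: "real measure" and \<Lambda> :: real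
  assumes "(a0, b0) \<in> U_region"
    and "is_acim a0 b0 \<mu>"
    and "is_lyapunov_exponent a0 b0 \<mu> \<Lambda>"
  shows "\<exists>D. (isentrope (kneading a0 b0) has_real_derivative D) (at a0) \<and>
           (let \<gamma> = (D / b0 + 1 / (1 - a0)) / (1 / a0 + 1 / (1 - a0))
            in \<gamma> = a0 * (1 - a0) * D / b0 + a0 \<and>
               \<Lambda> = \<gamma> * ln (b0 / a0) + (1 - \<gamma>) * ln (b0 / (1 - a0)) \<and>
               \<gamma> = measure \<mu> {0..a0})"
proof -
  interpret skew_tent_map a0 b0 by unfold_locales (rule assms(1))
  note nz = acim_left_mass(1)[OF assms(2)]
  define g where "g = measure \<mu> {0..a0}"
  \<comment> \<open>The formula for \<gamma> solved for the derivative, with \<gamma> replaced by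
    the mass g; the algebra below inverts it.\<close>
  define D where "D = b0 * (g / a0 - (1 - g) / (1 - a0))"
  have g: "vL b0 / (vL b0 + vR b0) = g"
    using acim_left_mass[OF assms(2)] by (simp add: g_def field_simps)
  have "(isentrope (kneading a0 b0) has_real_derivative D) (at a0)"
    using isentrope_has_derivative[OF nz] unfolding g D_def .
  moreover have db: "D / b0 = g / a0 - (1 - g) / (1 - a0)"
    using parameters by (simp add: D_def)
  have "(D / b0 + 1 / (1 - a0)) / (1 / a0 + 1 / (1 - a0)) = g"
  proof -
    have "D / b0 + 1 / (1 - a0) = g * (1 / a0 + 1 / (1 - a0))"
      unfolding db by (simp add: diff_divide_distrib distrib_left)
    moreover have "0 < 1 / a0 + 1 / (1 - a0)" using parameters by (intro add_pos_pos) auto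
    ultimately show ?thesis by simp
  qed
  moreover have "a0 * (1 - a0) * D / b0 + a0 = g"
  proof -
    have "a0 * (1 - a0) * D / b0 = a0 * (1 - a0) * (g / a0 - (1 - g) / (1 - a0))"
      unfolding db[symmetric] by simp
    also have "\<dots> = (1 - a0) * g - a0 * (1 - g)"
    proof -
      have "a0 * (1 - a0) * (g / a0) = (1 - a0) * g" "a0 * (1 - a0) * ((1 - g) / (1 - a0)) = a0 * (1 - g)"
        using parameters by simp_all
      then show ?thesis by (simp only: right_diff_distrib[of "a0 * (1 - a0)"])
    qed
    finally show ?thesis by (simp add: algebra_simps)
  qed
  moreover have "\<Lambda> = g * ln (b0 / a0) + (1 - g) * ln (b0 / (1 - a0))"
    using lyapunov_exponent_eq[OF assms(2,3)] unfolding g_def p_def q_def .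
  ultimately show ?thesis
    unfolding Let_def by (intro exI[of _ D]) (simp add: g_def)
qed

end
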